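(* Let $\alpha\in\mathbb{R}$. Up to a linear isometry and a dilation of $\mathbb{L}^2$, the $\alpha$-stationary timelike curves contained in $\mathcal{C}^+$ are parametrized by $\gamma(s)=\rho(s)(\cosh s,\sinh s)$, where $$\rho(s)=\begin{cases}\cosh((\alpha-1)s)^{\frac{1}{\alpha-1}}, & \alpha\neq 1,\\ e^{cs}, & \alpha=1,\ c>1\ (c\in\mathbb{R}\text{ constant}).\end{cases}$$ Moreover: (1) If $\alpha>1$, then $\gamma$ has the two branches asymptotic to a vertical translation of the lightlike cone $\mathcal{C}$. (2) If $\alpha=1$, then $\gamma$ is a pseudocircle $\mathbb{S}^1_1(r)$ centered at the origin or the two branches of $\gamma$ are asymptotic to $\mathcal{C}$. (3) If $0<\alpha<1$, then $\gamma$ meets $\mathcal{C}$ tangentially at two points. (4) If $\alpha<0$, then $\gamma$ intersects $\mathcal{C}$ orthogonally at two points.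
   Context: $\mathbb{L}^2=(\mathbb{R}^2,\langle\cdot,\cdot\rangle)$ with $\langle\cdot,\cdot\rangle=dx^2-dy^2$, where $(x,y)$ are the canonical coordinates (the $y$-direction is the vertical one). $\mathcal{C}=\{p\in\mathbb{L}^2:\langle p,p\rangle=0\}$ is the lightlike cone and $\mathcal{C}^+=\{p:\langle p,p\rangle>0\}$. A smooth regular curve is spacelike (resp. timelike) if $\langle\gamma',\gamma'\rangle>0$ (resp. $<0$) everywhere. Let $N$ be a unit normal field along $\gamma$ ($\langle N,\gamma'\rangle=0$, $|\langle N,N\rangle|=1$). When $\gamma$ is parametrized by arc-length ($|\langle\gamma',\gamma'\rangle|=1$) its curvature is $\kappa=-\langle N,\gamma''\rangle$. A spacelike or timelike curve $\gamma\colon I\to\mathbb{L}^2$ with $\gamma(I)\cap\mathcal{C}=\emptyset$ is called $\alpha$-stationary if $\kappa=-\alpha\,\dfrac{\langle N,\gamma\rangle}{|\langle\gamma,\gamma\rangle|}$ along $\gamma$ (this condition does not depend on the choice of sign of $N$). A pseudocircle $\mathbb{S}^1_1(r)$, $r>0$, is one of the two components of $\{p:\langle p,p\rangle=r^2\}$. A dilation is a map $p\mapsto\lambda p$, $\lambda>0$. Curves are considered on their maximal domain $s\in\mathbb{R}$, and the two branches are the ends $s\to\pm\infty$. A branch is asymptotic to $\mathcal{C}$ or to a translation of $\mathcal{C}$ if it approaches one of the two lines forming that (translated) cone. "Meets/intersects $\mathcal{C}$" is understood in the limit: $\gamma(s)$ tends as $s\to\pm\infty$ to a nonzero point of $\mathcal{C}$,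 and the contact is tangential (resp. orthogonal) if the limit of the tangent direction is that of the line of $\mathcal{C}$ through the limit point (resp. is perpendicular to it in the Euclidean sense).
   Formalization: For α=1 the condition c>1 (which gives spacelike curves) is replaced by |c|<1; in (1) no single vertical translation of the cone serves both branches, so each branch is asymptotic to its own vertical translation and both to one common translation of the cone. *)

theory Defs
  imports "HOL-Analysis.Analysis"
begin

text \<open>The Lorentz-Minkowski plane is \<open>real \<times> real\<close> with the following scalar product;
  \<open>snd\<close> is the vertical coordinate. The topology and the norm are the Euclidean ones.\<close>

definition lprod :: "real \<times> real \<Rightarrow> real \<times> real \<Rightarrow> real" where
  "lprod p q = fst p * fst q - snd p * snd q"

definition light_cone :: "(real \<times> real) set" where
  "light_cone = {p. lprod p p = 0}"

definition cone_plus :: "(real \<times> real) set" where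
  "cone_plus = {p. lprod p p > 0}"

definition linear_isometry :: "(real \<times> real \<Rightarrow> real \<times> real) \<Rightarrow> bool" where
  "linear_isometry L \<longleftrightarrow> linear L \<and> (\<forall>p q. lprod (L p) (L q) = lprod p q)"

text \<open>\<open>nth_vderiv n f\<close> is the \<open>n\<close>-th derivative of \<open>f\<close>. At a point where \<open>f\<close> is not
  differentiable, \<open>vector_derivative\<close> has an unspecified value, so derivatives are only
  meaningful together with \<open>smooth_on_interval\<close>.\<close>

definition nth_vderiv :: "nat \<Rightarrow> (real \<Rightarrow> 'a::real_normed_vector) \<Rightarrow> real \<Rightarrow> 'a" where
  "nth_vderiv n = ((\<lambda>g t. vector_derivative g (at t)) ^^ n)"

definition open_interval :: "real set \<Rightarrow> bool" where
  "open_interval I \<longleftrightarrow> open I \<and> is_interval I \<and> I \<noteq> {}"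

definition smooth_on_interval :: "real set \<Rightarrow> (real \<Rightarrow> 'a::real_normed_vector) \<Rightarrow> bool" where
  "smooth_on_interval I f \<longleftrightarrow>
     open_interval I \<and> (\<forall>n. \<forall>t\<in>I. nth_vderiv n f differentiable (at t))"

definition spacelike_curve :: "real set \<Rightarrow> (real \<Rightarrow> real \<times> real) \<Rightarrow> bool" where
  "spacelike_curve I \<gamma> \<longleftrightarrow> smooth_on_interval I \<gamma> \<and>
     (\<forall>t\<in>I. lprod (nth_vderiv 1 \<gamma> t) (nth_vderiv 1 \<gamma> t) > 0)"

definition timelike_curve :: "real set \<Rightarrow> (real \<Rightarrow> real \<times> real) \<Rightarrow> bool" where
  "timelike_curve I \<gamma> \<longleftrightarrow> smooth_on_interval I \<gamma> \<and>
     (\<forall>t\<in>I. lprod (nth_vderiv 1 \<gamma> t) (nth_vderiv 1 \<gamma> t) < 0)"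

definition unit_normal_field ::
  "real set \<Rightarrow> (real \<Rightarrow> real \<times> real) \<Rightarrow> (real \<Rightarrow> real \<times> real) \<Rightarrow> bool" where
  "unit_normal_field I \<gamma> N \<longleftrightarrow> smooth_on_interval I N \<and>
     (\<forall>t\<in>I. lprod (N t) (nth_vderiv 1 \<gamma> t) = 0 \<and> \<bar>lprod (N t) (N t)\<bar> = 1)"

definition arc_length_parametrized :: "real set \<Rightarrow> (real \<Rightarrow> real \<times> real) \<Rightarrow> bool" where
  "arc_length_parametrized I \<gamma> \<longleftrightarrow>
     (\<forall>t\<in>I. \<bar>lprod (nth_vderiv 1 \<gamma> t) (nth_vderiv 1 \<gamma> t)\<bar> = 1)"

text \<open>The curvature with respect to \<open>N\<close>; only used for curves parametrized by arc-length.\<close>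

definition arc_length_curvature ::
  "(real \<Rightarrow> real \<times> real) \<Rightarrow> (real \<Rightarrow> real \<times> real) \<Rightarrow> real \<Rightarrow> real" where
  "arc_length_curvature \<gamma> N t = - lprod (N t) (nth_vderiv 2 \<gamma> t)"

text \<open>A smooth \<open>\<psi>\<close> with nowhere vanishing derivative on the interval \<open>J\<close> is a diffeomorphism
  onto its image, which is an open interval. Reversal of orientation is allowed.\<close>

definition change_of_parameter :: "(real \<Rightarrow> real) \<Rightarrow> real set \<Rightarrow> real set \<Rightarrow> bool" where
  "change_of_parameter \<psi> J I \<longleftrightarrow>
     smooth_on_interval J \<psi> \<and> (\<forall>s\<in>J. nth_vderiv 1 \<psi> s \<noteq> 0) \<and> \<psi> ` J = I"

text \<open>For a curve with an arbitrary regular parametrization, the equation is imposed on an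
  arc-length reparametrization; neither the choice of \<open>\<psi>\<close> nor that of \<open>N\<close> matters.\<close>

definition alpha_stationary :: "real \<Rightarrow> real set \<Rightarrow> (real \<Rightarrow> real \<times> real) \<Rightarrow> bool" where
  "alpha_stationary \<alpha> I \<gamma> \<longleftrightarrow>
     (spacelike_curve I \<gamma> \<or> timelike_curve I \<gamma>) \<and> \<gamma> ` I \<inter> light_cone = {} \<and>
     (\<exists>J \<psi> N. change_of_parameter \<psi> J I \<and>
        arc_length_parametrized J (\<gamma> \<circ> \<psi>) \<and> unit_normal_field J (\<gamma> \<circ> \<psi>) N \<and>
        (\<forall>s\<in>J. arc_length_curvature (\<gamma> \<circ> \<psi>) N s =
           - \<alpha> * (lprod (N s) (\<gamma> (\<psi> s)) / \<bar>lprod (\<gamma> (\<psi> s)) (\<gamma> (\<psi> s))\<bar>)))"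

definition stationary_timelike_in_cone_plus ::
  "real \<Rightarrow> real set \<Rightarrow> (real \<Rightarrow> real \<times> real) \<Rightarrow> bool" where
  "stationary_timelike_in_cone_plus \<alpha> I \<gamma> \<longleftrightarrow>
     alpha_stationary \<alpha> I \<gamma> \<and> timelike_curve I \<gamma> \<and> \<gamma> ` I \<subseteq> cone_plus"

text \<open>Maximality: up to a change of parameter, the curve is not a proper arc of another
  curve of the same kind.\<close>

definition maximal_stationary_timelike_in_cone_plus ::
  "real \<Rightarrow> real set \<Rightarrow> (real \<Rightarrow> real \<times> real) \<Rightarrow> bool" where
  "maximal_stationary_timelike_in_cone_plus \<alpha> I \<gamma> \<longleftrightarrow>
     stationary_timelike_in_cone_plus \<alpha> I \<gamma> \<and>
     (\<forall>J \<beta> \<psi> K. stationary_timelike_in_cone_plus \<alpha> J \<beta> \<and> change_of_parameter \<psi> I K \<and>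
        K \<subseteq> J \<and> (\<forall>t\<in>I. \<gamma> t = \<beta> (\<psi> t)) \<longrightarrow> K = J)"

definition rho :: "real \<Rightarrow> real \<Rightarrow> real \<Rightarrow> real" where
  "rho \<alpha> c s = (if \<alpha> \<noteq> 1 then cosh ((\<alpha> - 1) * s) powr (1 / (\<alpha> - 1)) else exp (c * s))"

definition model_curve :: "real \<Rightarrow> real \<Rightarrow> real \<Rightarrow> real \<times> real" where
  "model_curve \<alpha> c s = rho \<alpha> c s *\<^sub>R (cosh s, sinh s)"

text \<open>The constant \<open>c\<close> only enters for \<open>\<alpha> = 1\<close>. The velocity of
  \<open>exp (c * s) *\<^sub>R (cosh s, sinh s)\<close> has square \<open>(c\<^sup>2 - 1) * exp (2 * c * s)\<close>, so this
  curve is timelike exactly when \<open>\<bar>c\<bar> < 1\<close>; \<open>c = 0\<close> is the pseudocircle.\<close>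

definition admissible :: "real \<Rightarrow> real \<Rightarrow> bool" where
  "admissible \<alpha> c \<longleftrightarrow> (\<alpha> = 1 \<longrightarrow> \<bar>c\<bar> < 1)"

definition pseudocircle :: "real \<Rightarrow> (real \<times> real) set \<Rightarrow> bool" where
  "pseudocircle r S \<longleftrightarrow> r > 0 \<and> S \<in> components {p. lprod p p = r\<^sup>2}"

text \<open>The two lines whose union is \<open>light_cone\<close>.\<close>

definition cone_lines :: "(real \<times> real) set set" where
  "cone_lines = {{p. snd p = fst p}, {p. snd p = - fst p}}"

text \<open>Below, the filter \<open>F\<close> is \<open>at_top\<close> or \<open>at_bot\<close> and selects a branch of the curve.\<close>

definition asymptotic_to_cone_at ::
  "(real \<Rightarrow> real \<times> real) \<Rightarrow> real filter \<Rightarrow> real \<times> real \<Rightarrow> bool" where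
  "asymptotic_to_cone_at \<gamma> F v \<longleftrightarrow> filterlim \<gamma> at_infinity F \<and>
     (\<exists>l\<in>cone_lines. ((\<lambda>s. infdist (\<gamma> s) ((+) v ` l)) \<longlongrightarrow> 0) F)"

text \<open>\<open>sgn\<close> of a nonzero vector is its Euclidean normalization. The line of the cone through
  a point \<open>p \<noteq> 0\<close> of the cone is \<open>span {p}\<close>.\<close>

definition meets_cone_tangentially ::
  "(real \<Rightarrow> real \<times> real) \<Rightarrow> real filter \<Rightarrow> real \<times> real \<Rightarrow> bool" where
  "meets_cone_tangentially \<gamma> F p \<longleftrightarrow> p \<in> light_cone \<and> p \<noteq> 0 \<and> (\<gamma> \<longlongrightarrow> p) F \<and>
     (\<exists>u. norm u = 1 \<and> ((\<lambda>s. sgn (nth_vderiv 1 \<gamma> s)) \<longlongrightarrow> u) F \<and> u \<in> span {p})"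

definition meets_cone_orthogonally ::
  "(real \<Rightarrow> real \<times> real) \<Rightarrow> real filter \<Rightarrow> real \<times> real \<Rightarrow> bool" where
  "meets_cone_orthogonally \<gamma> F p \<longleftrightarrow> p \<in> light_cone \<and> p \<noteq> 0 \<and> (\<gamma> \<longlongrightarrow> p) F \<and>
     (\<exists>u. norm u = 1 \<and> ((\<lambda>s. sgn (nth_vderiv 1 \<gamma> s)) \<longlongrightarrow> u) F \<and> inner u p = 0)"

end

theory Submission
  imports Defs
begin

text \<open>Write \<open>u = x + y\<close> and \<open>v = x - y\<close>. In these null coordinates the square of a vector is
  \<open>u * v\<close>, and a linear isometry multiplies \<open>u\<close> by some \<open>a \<noteq> 0\<close> and divides \<open>v\<close> by \<open>a\<close>, possibly
  after exchanging the two. A timelike curve in \<open>cone_plus\<close> satisfies \<open>u * v > 0\<close> and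
  \<open>u' * v' < 0\<close>.

  Clearing denominators and dropping the unit normal turns stationarity into the equation
  \<open>stationary_eq\<close>, a polynomial in position, velocity and acceleration which is invariant under
  changes of parameter. To read it, put \<open>h = ln (u / v) / 2\<close>, the hyperbolic angle of the position;
  \<open>B = ln (- u' / v') / 2\<close>, the hyperbolic angle of the velocity reflected into \<open>cone_plus\<close>; and
  \<open>R = ln (u * v) / 2\<close>, the logarithm of the Lorentzian radius. The equation says exactly that
  \<open>B' = \<alpha> * h'\<close>: the velocity turns \<open>\<alpha>\<close> times as fast as the position. Hence \<open>B - h\<close> is
  \<open>(\<alpha> - 1) * h + d\<close> for a constant \<open>d\<close>. On the other hand \<open>R' = tanh (B - h) * h'\<close> holds for every
  timelike curve in \<open>cone_plus\<close>, so \<open>R\<close> is an antiderivative of \<open>tanh ((\<alpha> - 1) * h + d)\<close> with respect to \<open>h\<close>. For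
  \<open>\<alpha> \<noteq> 1\<close> the constant \<open>d\<close> is removed by translating \<open>h\<close>, that is, by a boost, and \<open>exp R\<close> is
  \<open>rho\<close> up to a factor, the dilation. For \<open>\<alpha> = 1\<close> the slope is the constant \<open>c = tanh d\<close>, so
  \<open>\<bar>c\<bar> < 1\<close>. This is lemma \<open>timelike_solution_is_model\<close>; its converse
  \<open>model_image_timelike_solution\<close> is a computation in null coordinates.

  The angle \<open>h\<close> is injective along every timelike curve in \<open>cone_plus\<close> and takes all real values along
  a complete model curve. An extension would have to repeat an angle, so the complete model curves are
  the maximal ones.

  Along a model curve \<open>u = rho * exp s\<close> and \<open>v = rho * exp (- s)\<close>, and for \<open>\<alpha> \<noteq> 1\<close> the velocity
  satisfies \<open>v' = - exp (- 2 * \<alpha> * s) * u'\<close>. At each end, for \<open>\<alpha> > 1\<close> one null coordinate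
  diverges while the other has a nonzero limit, which gives the asymptote; for \<open>\<alpha> < 1\<close> one tends to a
  nonzero limit and the other to zero, so the curve reaches the cone, and the ratio
  \<open>exp (- 2 * \<alpha> * s)\<close> decides by the sign of \<open>\<alpha>\<close> along which of the two null directions it arrives.\<close>

\<comment> \<open>Keeps the order in \<open>nth_vderiv 1\<close> from being rewritten to \<open>Suc 0\<close>.\<close>
declare One_nat_def [simp del]

section \<open>Smooth functions of one real variable\<close>

text \<open>Derivatives are carried as functions constrained only on \<open>S\<close>. The closure properties below are then
  plain inductions on the order, in which the unspecified values of \<open>vector_derivative\<close> outside \<open>S\<close>
  never occur.\<close>

primrec ndiff :: "nat \<Rightarrow> real set \<Rightarrow> (real \<Rightarrow> 'a::real_normed_vector) \<Rightarrow> bool" where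
  "ndiff 0 S f \<longleftrightarrow> True"
| "ndiff (Suc n) S f \<longleftrightarrow>
     (\<exists>f'. (\<forall>t\<in>S. (f has_vector_derivative f' t) (at t)) \<and> ndiff n S f')"

definition smooth :: "real set \<Rightarrow> (real \<Rightarrow> 'a::real_normed_vector) \<Rightarrow> bool" where
  "smooth S f \<longleftrightarrow> (\<forall>n. ndiff n S f)"

lemma ndiff_Suc_I:
  assumes "\<And>t. t \<in> S \<Longrightarrow> (f has_vector_derivative f' t) (at t)" "ndiff n S f'"
  shows "ndiff (Suc n) S f"
  using assms by auto

lemma ndiff_Suc_imp: "ndiff (Suc n) S f \<Longrightarrow> ndiff n S f"
  by (induction n arbitrary: f) auto

lemma ndiff_cong:
  assumes "open S" "\<And>t. t \<in> S \<Longrightarrow> f t = g t" "ndiff n S f"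
  shows "ndiff n S g"
proof (cases n)
  case (Suc k)
  then obtain f' where f': "\<And>t. t \<in> S \<Longrightarrow> (f has_vector_derivative f' t) (at t)" "ndiff k S f'"
    using assms(3) by auto
  have "(g has_vector_derivative f' t) (at t)" if "t \<in> S" for t
    using f'(1)[OF that] assms(1) that assms(2) by (rule has_vector_derivative_transform_within_open)
  then show ?thesis using Suc f'(2) by auto
qed simp

lemma nth_vderiv_0 [simp]: "nth_vderiv 0 f = f"
  by (simp add: nth_vderiv_def)

lemma nth_vderiv_1: "nth_vderiv 1 f t = vector_derivative f (at t)"
  by (simp add: nth_vderiv_def One_nat_def)

lemma nth_vderiv_2: "nth_vderiv 2 f = nth_vderiv 1 (nth_vderiv 1 f)"
  by (simp add: nth_vderiv_def numeral_2_eq_2 One_nat_def)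

lemma nth_vderiv_Suc: "nth_vderiv (Suc n) f = nth_vderiv n (nth_vderiv 1 f)"
  by (simp add: nth_vderiv_def funpow_Suc_right One_nat_def del: funpow.simps)

lemma nth_vderiv_1_eq:
  "(f has_vector_derivative d) (at t) \<Longrightarrow> nth_vderiv 1 f t = d"
  by (simp add: nth_vderiv_1 vector_derivative_at)

lemma has_vector_derivative_nth_vderiv_1:
  "f differentiable (at t) \<Longrightarrow> (f has_vector_derivative nth_vderiv 1 f t) (at t)"
  by (simp add: nth_vderiv_1 vector_derivative_works)

lemma nth_vderiv_2_eq:
  assumes "open S" "t \<in> S" "\<And>x. x \<in> S \<Longrightarrow> (f has_vector_derivative f' x) (at x)"
    "(f' has_vector_derivative d) (at t)"
  shows "nth_vderiv 2 f t = d"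
proof -
  have "(nth_vderiv 1 f has_vector_derivative d) (at t)"
    by (rule has_vector_derivative_transform_within_open[OF assms(4) assms(1,2)])
       (rule nth_vderiv_1_eq[symmetric, OF assms(3)])
  then show ?thesis unfolding nth_vderiv_2 by (rule nth_vderiv_1_eq)
qed

lemma ndiff_Suc_iff:
  assumes "open S"
  shows "ndiff (Suc n) S f \<longleftrightarrow> (\<forall>t\<in>S. f differentiable (at t)) \<and> ndiff n S (nth_vderiv 1 f)"
proof
  assume "ndiff (Suc n) S f"
  then obtain f' where f': "\<And>t. t \<in> S \<Longrightarrow> (f has_vector_derivative f' t) (at t)" "ndiff n S f'"
    by auto
  moreover have "ndiff n S (nth_vderiv 1 f)"
    by (rule ndiff_cong[OF assms _ f'(2)]) (rule nth_vderiv_1_eq[symmetric, OF f'(1)])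
  ultimately show "(\<forall>t\<in>S. f differentiable (at t)) \<and> ndiff n S (nth_vderiv 1 f)"
    by (meson differentiableI_vector)
qed (auto intro: has_vector_derivative_nth_vderiv_1)

lemma ndiff_iff_nth_vderiv:
  assumes "open S"
  shows "ndiff n S f \<longleftrightarrow> (\<forall>m<n. \<forall>t\<in>S. nth_vderiv m f differentiable (at t))"
proof (induction n arbitrary: f)
  case (Suc n)
  show ?case
    unfolding ndiff_Suc_iff[OF assms] Suc All_less_Suc2 by (simp add: nth_vderiv_Suc)
qed simp

lemma smooth_on_interval_iff: "smooth_on_interval I f \<longleftrightarrow> open_interval I \<and> smooth I f"
proof -
  have "(\<forall>n. \<forall>t\<in>I. nth_vderiv n f differentiable (at t)) \<longleftrightarrow> smooth I f" if "open I"
    unfolding smooth_def ndiff_iff_nth_vderiv[OF that] by blast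
  then show ?thesis
    by (auto simp: smooth_on_interval_def open_interval_def)
qed

lemma smooth_cong: "open S \<Longrightarrow> (\<And>t. t \<in> S \<Longrightarrow> f t = g t) \<Longrightarrow> smooth S f \<Longrightarrow> smooth S g"
  unfolding smooth_def using ndiff_cong by blast

lemma smooth_subset:
  assumes "smooth S f" "T \<subseteq> S"
  shows "smooth T f"
proof -
  have "ndiff n S f \<Longrightarrow> ndiff n T f" for n
    using assms(2) by (induction n arbitrary: f) (simp, simp, blast)
  then show ?thesis using assms(1) by (simp add: smooth_def)
qed

lemma smooth_derivative:
  assumes "smooth S f" "open S"
  shows "smooth S (nth_vderiv 1 f)"
    and "t \<in> S \<Longrightarrow> (f has_vector_derivative nth_vderiv 1 f t) (at t)"
    and "t \<in> S \<Longrightarrow> (nth_vderiv 1 f has_vector_derivative nth_vderiv 2 f t) (at t)"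
proof -
  have s: "smooth S (nth_vderiv 1 g)" "t \<in> S \<Longrightarrow> (g has_vector_derivative nth_vderiv 1 g t) (at t)"
    if "smooth S g" for g :: "real \<Rightarrow> 'a"
    using that ndiff_Suc_iff[OF assms(2)] unfolding smooth_def
    by (blast intro: has_vector_derivative_nth_vderiv_1)+
  show "smooth S (nth_vderiv 1 f)" "t \<in> S \<Longrightarrow> (f has_vector_derivative nth_vderiv 1 f t) (at t)"
    by (rule s[OF assms(1)])+
  show "t \<in> S \<Longrightarrow> (nth_vderiv 1 f has_vector_derivative nth_vderiv 2 f t) (at t)"
    unfolding nth_vderiv_2 by (rule s(2)[OF s(1)[OF assms(1)]])
qed

lemma ndiff_const: "ndiff n S (\<lambda>t. k)"
  by (induction n arbitrary: k) (auto intro!: exI[of _ "\<lambda>t. 0"])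

lemma ndiff_add: "ndiff n S f \<Longrightarrow> ndiff n S g \<Longrightarrow> ndiff n S (\<lambda>t. f t + g t)"
proof (induction n arbitrary: f g)
  case (Suc n)
  then obtain f' g' where
    "\<And>t. t \<in> S \<Longrightarrow> (f has_vector_derivative f' t) (at t)" "ndiff n S f'"
    "\<And>t. t \<in> S \<Longrightarrow> (g has_vector_derivative g' t) (at t)" "ndiff n S g'"
    using Suc.prems by simp meson
  then show ?case
    by (intro ndiff_Suc_I[where f' = "\<lambda>t. f' t + g' t"] has_vector_derivative_add Suc.IH)
qed simp

lemma ndiff_scaleR:
  fixes f :: "real \<Rightarrow> real"
  shows "ndiff n S f \<Longrightarrow> ndiff n S g \<Longrightarrow> ndiff n S (\<lambda>t. f t *\<^sub>R g t)"
proof (induction n arbitrary: f g)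
  case (Suc n)
  then obtain f' g' where d:
    "\<And>t. t \<in> S \<Longrightarrow> (f has_vector_derivative f' t) (at t)" "ndiff n S f'"
    "\<And>t. t \<in> S \<Longrightarrow> (g has_vector_derivative g' t) (at t)" "ndiff n S g'"
    using Suc.prems by simp meson
  have "ndiff n S (\<lambda>t. f t *\<^sub>R g' t + f' t *\<^sub>R g t)"
    using Suc d by (intro ndiff_add Suc.IH) (auto dest: ndiff_Suc_imp simp del: ndiff.simps)
  with d show ?case
    by (intro ndiff_Suc_I[where f' = "\<lambda>t. f t *\<^sub>R g' t + f' t *\<^sub>R g t"]
        has_vector_derivative_scaleR) (auto simp: has_real_derivative_iff_has_vector_derivative)
qed simp

text \<open>The chain rule expresses the derivative of \<open>f \<circ> g\<close> through \<open>f' \<circ> g\<close> and \<open>g'\<close>, so the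
  induction needs products at the same order.\<close>

lemma ndiff_compose:
  fixes g :: "real \<Rightarrow> real"
  shows "ndiff n S g \<Longrightarrow> g ` S \<subseteq> T \<Longrightarrow> ndiff n T f \<Longrightarrow> ndiff n S (\<lambda>t. f (g t))"
proof (induction n arbitrary: f)
  case (Suc n)
  then obtain f' g' where d:
    "\<And>t. t \<in> T \<Longrightarrow> (f has_vector_derivative f' t) (at t)" "ndiff n T f'"
    "\<And>t. t \<in> S \<Longrightarrow> (g has_vector_derivative g' t) (at t)" "ndiff n S g'"
    using Suc.prems by simp meson
  have "ndiff n S (\<lambda>t. g' t *\<^sub>R f' (g t))"
    using Suc d by (intro ndiff_scaleR Suc.IH) (auto dest: ndiff_Suc_imp simp del: ndiff.simps)
  moreover have "((\<lambda>t. f (g t)) has_vector_derivative g' t *\<^sub>R f' (g t)) (at t)" if "t \<in> S" for t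
    using vector_diff_chain_at[OF d(3)[OF that] d(1)] Suc.prems(2) that by (auto simp: o_def)
  ultimately show ?case by (rule ndiff_Suc_I[rotated])
qed simp

lemma smooth_const: "smooth S (\<lambda>t. k)"
  by (simp add: smooth_def ndiff_const)

lemma smooth_id: "smooth S (\<lambda>t. t)"
  unfolding smooth_def
proof
  fix n show "ndiff n S (\<lambda>t. t)"
    by (cases n) (auto intro!: exI[of _ "\<lambda>t. 1"] ndiff_const)
qed

lemma smooth_add: "smooth S f \<Longrightarrow> smooth S g \<Longrightarrow> smooth S (\<lambda>t. f t + g t)"
  by (simp add: smooth_def ndiff_add)

lemma smooth_scaleR:
  fixes f :: "real \<Rightarrow> real"
  shows "smooth S f \<Longrightarrow> smooth S g \<Longrightarrow> smooth S (\<lambda>t. f t *\<^sub>R g t)"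
  by (simp add: smooth_def ndiff_scaleR)

lemma smooth_mult:
  fixes f :: "real \<Rightarrow> real"
  shows "smooth S f \<Longrightarrow> smooth S g \<Longrightarrow> smooth S (\<lambda>t. f t * g t)"
  using smooth_scaleR[of S f g] by simp

lemma smooth_compose:
  fixes g :: "real \<Rightarrow> real"
  shows "smooth S g \<Longrightarrow> g ` S \<subseteq> T \<Longrightarrow> smooth T f \<Longrightarrow> smooth S (\<lambda>t. f (g t))"
  unfolding smooth_def using ndiff_compose by blast

lemma smooth_bounded_linear:
  assumes "bounded_linear L" "smooth S f"
  shows "smooth S (\<lambda>t. L (f t))"
proof -
  have "ndiff n S (\<lambda>t. L (f t))" if "ndiff n S f" for n
    using that
  proof (induction n arbitrary: f)
    case (Suc n)
    then obtain f' where "\<And>t. t \<in> S \<Longrightarrow> (f has_vector_derivative f' t) (at t)" "ndiff n S f'"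
      by auto
    then show ?case
      by (intro ndiff_Suc_I[where f' = "\<lambda>t. L (f' t)"] Suc.IH
          bounded_linear.has_vector_derivative[OF assms(1)])
  qed simp
  then show ?thesis using assms(2) by (simp add: smooth_def)
qed

lemma smooth_Pair:
  assumes "smooth S f" "smooth S g"
  shows "smooth S (\<lambda>t. (f t, g t))"
proof -
  have "ndiff n S (\<lambda>t. (f t, g t))" if "ndiff n S f" "ndiff n S g" for n
    using that
  proof (induction n arbitrary: f g)
    case (Suc n)
    then obtain f' g' where
      "\<And>t. t \<in> S \<Longrightarrow> (f has_vector_derivative f' t) (at t)" "ndiff n S f'"
      "\<And>t. t \<in> S \<Longrightarrow> (g has_vector_derivative g' t) (at t)" "ndiff n S g'"
      using Suc.prems by simp meson
    then show ?case
      by (intro ndiff_Suc_I[where f' = "\<lambda>t. (f' t, g' t)"] has_vector_derivative_Pair Suc.IH)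
  qed simp
  then show ?thesis using assms by (simp add: smooth_def)
qed

text \<open>The derivative of \<open>inverse\<close> is a polynomial in \<open>inverse\<close> itself; this feeds the induction.\<close>

lemma ndiff_inverse: "ndiff n (- {0}) (inverse :: real \<Rightarrow> real)"
proof (induction n)
  case (Suc n)
  have "ndiff n (- {0}) (\<lambda>t::real. - 1 *\<^sub>R (inverse t *\<^sub>R inverse t))"
    by (intro ndiff_scaleR ndiff_const Suc)
  moreover have "((inverse :: real \<Rightarrow> real) has_vector_derivative - 1 *\<^sub>R (inverse t *\<^sub>R inverse t)) (at t)"
    if "t \<in> - {0}" for t
    unfolding has_real_derivative_iff_has_vector_derivative[symmetric]
    using that by (auto intro!: derivative_eq_intros simp: power2_eq_square)
  ultimately show ?case by (rule ndiff_Suc_I[rotated])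
qed simp

lemma smooth_inverse:
  fixes f :: "real \<Rightarrow> real"
  assumes "smooth S f" "\<And>t. t \<in> S \<Longrightarrow> f t \<noteq> 0"
  shows "smooth S (\<lambda>t. inverse (f t))"
  by (rule smooth_compose[OF assms(1), where T = "- {0}"])
     (use assms(2) in \<open>auto simp: smooth_def ndiff_inverse\<close>)

lemma smooth_exp:
  fixes f :: "real \<Rightarrow> real"
  assumes "smooth S f"
  shows "smooth S (\<lambda>t. exp (f t))"
proof -
  have "ndiff n UNIV (exp :: real \<Rightarrow> real)" for n
  proof (induction n)
    case (Suc n)
    then show ?case
      by (rule ndiff_Suc_I[rotated])
         (auto simp: has_real_derivative_iff_has_vector_derivative[symmetric])
  qed simp
  then show ?thesis
    by (intro smooth_compose[OF assms, where T = UNIV]) (auto simp: smooth_def)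
qed

lemma smooth_ln:
  fixes f :: "real \<Rightarrow> real"
  assumes "smooth S f" "\<And>t. t \<in> S \<Longrightarrow> f t > 0"
  shows "smooth S (\<lambda>t. ln (f t))"
proof -
  have "ndiff n {0<..} (ln :: real \<Rightarrow> real)" for n
  proof (cases n)
    case (Suc k)
    have "smooth {0<..} (\<lambda>t::real. inverse t)"
      by (rule smooth_inverse[OF smooth_id]) auto
    then have "ndiff k {0<..} (\<lambda>t::real. inverse t)"
      by (simp add: smooth_def)
    then show ?thesis
      unfolding Suc by (rule ndiff_Suc_I[rotated])
        (auto simp: has_real_derivative_iff_has_vector_derivative[symmetric]
          intro!: derivative_eq_intros simp: inverse_eq_divide)
  qed simp
  then show ?thesis
    by (intro smooth_compose[OF assms(1), where T = "{0<..}"])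
       (use assms(2) in \<open>auto simp: smooth_def\<close>)
qed

section \<open>Changes of parameter and arc length\<close>

lemma smooth_imp_continuous_on:
  assumes "smooth S f" "open S"
  shows "continuous_on S f"
  using smooth_derivative(2)[OF assms] has_vector_derivative_continuous
  by (blast intro: continuous_at_imp_continuous_on)

text \<open>By Rolle's theorem two parameters with the same value would enclose a zero of the derivative.\<close>

lemma inj_on_nonzero_derivative:
  fixes f :: "real \<Rightarrow> real"
  assumes "is_interval I" "\<And>t. t \<in> I \<Longrightarrow> (f has_real_derivative f' t) (at t)"
    "\<And>t. t \<in> I \<Longrightarrow> f' t \<noteq> 0"
  shows "inj_on f I"
proof -
  have False if xy: "x \<in> I" "y \<in> I" "x < y" "f x = f y" for x y
  proof -
    have I: "{x..y} \<subseteq> I"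
      using mem_is_interval_1_I[OF assms(1) xy(1,2)] by auto
    have d: "\<And>t. x \<le> t \<Longrightarrow> t \<le> y \<Longrightarrow> (f has_real_derivative f' t) (at t)"
      using I assms(2) by auto
    have "continuous_on {x..y} f"
      by (intro continuous_at_imp_continuous_on ballI) (use d DERIV_isCont in fastforce)
    moreover have "f differentiable (at t)" if "x < t" "t < y" for t
      using d[of t] that real_differentiable_def by auto
    ultimately obtain z where z: "x < z" "z < y" "(f has_real_derivative 0) (at z)"
      using Rolle[OF xy(3,4)] by blast
    then have "f' z = 0"
      using DERIV_unique d[of z] by auto
    moreover have "z \<in> I"
      using z(1,2) by (intro subsetD[OF I]) simp
    ultimately show False
      using assms(3) by blast
  qed
  then show ?thesis
    unfolding inj_on_def by (metis linorder_neqE_linordered_idom)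
qed

lemma change_of_parameter_derivative:
  assumes "change_of_parameter \<psi> J I"
  shows "open J" "is_interval J" "J \<noteq> {}" "smooth J \<psi>" "\<psi> ` J = I"
    and "\<And>t. t \<in> J \<Longrightarrow> nth_vderiv 1 \<psi> t \<noteq> 0"
    and "\<And>t. t \<in> J \<Longrightarrow> (\<psi> has_real_derivative nth_vderiv 1 \<psi> t) (at t)"
  using assms smooth_derivative(2)[of J \<psi>]
  unfolding change_of_parameter_def smooth_on_interval_iff open_interval_def
    has_real_derivative_iff_has_vector_derivative by auto

lemma change_of_parameter_inj: "change_of_parameter \<psi> J I \<Longrightarrow> inj_on \<psi> J"
  by (rule inj_on_nonzero_derivative) (auto dest: change_of_parameter_derivative)

lemma change_of_parameter_open_interval:
  assumes "change_of_parameter \<psi> J I"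
  shows "open_interval I"
proof -
  note c = change_of_parameter_derivative[OF assms]
  have cont: "continuous_on J \<psi>" by (rule smooth_imp_continuous_on[OF c(4,1)])
  have "open (\<psi> ` J)"
    by (rule invariance_of_domain[OF cont c(1) change_of_parameter_inj[OF assms]])
  moreover have "is_interval (\<psi> ` J)"
    using connected_continuous_image[OF cont] c(2) is_interval_connected_1 by blast
  ultimately show ?thesis using c by (auto simp: open_interval_def)
qed

text \<open>The formula for the derivative of the inverse function contains that function, so each order of
  differentiability yields the next one.\<close>

lemma change_of_parameter_inverse:
  assumes "change_of_parameter \<psi> J I"
  shows "change_of_parameter (inv_into J \<psi>) I J"
    and "t \<in> I \<Longrightarrow> nth_vderiv 1 (inv_into J \<psi>) t = inverse (nth_vderiv 1 \<psi> (inv_into J \<psi> t))"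
proof -
  note c = change_of_parameter_derivative[OF assms]
  note I = change_of_parameter_open_interval[OF assms]
  note inj = change_of_parameter_inj[OF assms]
  let ?g = "inv_into J \<psi>"
  have g: "?g t \<in> J" "\<psi> (?g t) = t" if "t \<in> I" for t
    using that c(5) by (auto intro: inv_into_into f_inv_into_f)
  have gi: "?g (\<psi> s) = s" if "s \<in> J" for s
    using that inj by simp
  have d: "(?g has_vector_derivative inverse (nth_vderiv 1 \<psi> (?g t))) (at t)" if t: "t \<in> I" for t
    unfolding has_real_derivative_iff_has_vector_derivative[symmetric] has_field_derivative_def
  proof (rule has_derivative_inverse_strong_x[where S = J and f = \<psi>])
    show "(\<psi> has_derivative (*) (nth_vderiv 1 \<psi> (?g t))) (at (?g t))"
      using c(7)[OF g(1)[OF t]] by (simp add: has_field_derivative_def)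
    show "(*) (nth_vderiv 1 \<psi> (?g t)) \<circ> (*) (inverse (nth_vderiv 1 \<psi> (?g t))) = id"
      using c(6)[OF g(1)[OF t]] by (auto simp: fun_eq_iff)
  qed (use c g gi t smooth_imp_continuous_on[OF c(4,1)] in auto)
  then show eq: "t \<in> I \<Longrightarrow> nth_vderiv 1 ?g t = inverse (nth_vderiv 1 \<psi> (?g t))" for t
    by (rule nth_vderiv_1_eq)
  have inv: "smooth J (\<lambda>s. inverse (nth_vderiv 1 \<psi> s))"
    by (intro smooth_inverse smooth_derivative(1) c(1,4,6))
  have "ndiff n I ?g" for n
  proof (induction n)
    case (Suc n)
    then have "ndiff n I (\<lambda>t. inverse (nth_vderiv 1 \<psi> (?g t)))"
      by (rule ndiff_compose[where T = J]) (use inv g in \<open>auto simp: smooth_def\<close>)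
    with d show ?case by (rule ndiff_Suc_I)
  qed simp
  moreover have "?g ` I = J"
    using g gi c(5) by force
  ultimately show "change_of_parameter ?g I J"
    using I eq g c(6) by (auto simp: change_of_parameter_def smooth_on_interval_iff smooth_def)
qed

text \<open>The interval may be unbounded, so its end points are taken among the extended reals.\<close>

lemma ex_antiderivative:
  fixes f :: "real \<Rightarrow> real"
  assumes "open_interval I" "smooth I f"
  shows "\<exists>F. \<forall>t\<in>I. (F has_real_derivative f t) (at t)"
proof -
  have I: "open I" "is_interval I" "I \<noteq> {}"
    using assms(1) by (auto simp: open_interval_def)
  \<comment> \<open>The interval is recovered as the set of reals strictly between \<open>a\<close> and \<open>b\<close>.\<close>
  define a where "a = Inf (ereal ` I)"
  define b where "b = Sup (ereal ` I)"
  have "connected I" using I(2) is_interval_connected_1 by blast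
  have ab: "a < ereal t" "ereal t < b" if t: "t \<in> I" for t
  proof -
    obtain e where e: "e > 0" "ball t e \<subseteq> I"
      using I(1) t open_contains_ball by blast
    then have "t - e / 2 \<in> I" "t + e / 2 \<in> I"
      by (auto simp: dist_real_def subset_iff)
    then have "a \<le> ereal (t - e / 2)" "ereal (t + e / 2) \<le> b"
      unfolding a_def b_def by (auto intro: Inf_lower Sup_upper)
    moreover have "ereal (t - e / 2) < ereal t" "ereal t < ereal (t + e / 2)"
      using e(1) by auto
    ultimately show "a < ereal t" "ereal t < b"
      using le_less_trans less_le_trans by blast+
  qed
  have mem: "t \<in> I" if "a < ereal t" "ereal t < b" for t
  proof -
    have "\<exists>x\<in>I. x < t" "\<exists>y\<in>I. t < y"
      using that unfolding a_def b_def Inf_less_iff less_Sup_iff by auto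
    then show ?thesis
      using I(2) by (meson less_imp_le mem_is_interval_1_I)
  qed
  obtain t0 where "t0 \<in> I" using I(3) by blast
  then have "a < b" using ab less_trans by blast
  moreover have "isCont f t" if "a < ereal t" "ereal t < b" for t
    using smooth_imp_continuous_on[OF assms(2) I(1)] I(1) mem[OF that]
    by (simp add: continuous_on_eq_continuous_at)
  ultimately obtain F where "\<And>t. a < ereal t \<Longrightarrow> ereal t < b \<Longrightarrow> (F has_vector_derivative f t) (at t)"
    using einterval_antiderivative[of a b f] by blast
  then show ?thesis
    using ab by (auto simp: has_real_derivative_iff_has_vector_derivative)
qed

text \<open>With \<open>f\<close> the speed of a curve, an antiderivative of \<open>f\<close> is arc length, and \<open>\<psi>\<close> is its inverse.\<close>

lemma ex_change_of_parameter_with_speed: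
  assumes "open_interval I" "smooth I f" "\<And>t. t \<in> I \<Longrightarrow> f t > 0"
  shows "\<exists>\<psi> J. change_of_parameter \<psi> J I \<and> (\<forall>s\<in>J. nth_vderiv 1 \<psi> s = inverse (f (\<psi> s)))"
proof -
  obtain F where F: "\<And>t. t \<in> I \<Longrightarrow> (F has_vector_derivative f t) (at t)"
    using ex_antiderivative[OF assms(1,2)]
    by (auto simp: has_real_derivative_iff_has_vector_derivative)
  have "ndiff n I F" for n
  proof (cases n)
    case (Suc k)
    show ?thesis
      unfolding Suc by (rule ndiff_Suc_I[OF F]) (use assms(2) in \<open>auto simp: smooth_def\<close>)
  qed simp
  moreover have dF: "nth_vderiv 1 F t = f t" if "t \<in> I" for t
    using F[OF that] by (rule nth_vderiv_1_eq)
  ultimately have c: "change_of_parameter F I (F ` I)"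
    using assms by (force simp: change_of_parameter_def smooth_on_interval_iff smooth_def)
  note inv = change_of_parameter_inverse[OF c]
  have "inv_into I F s \<in> I" if "s \<in> F ` I" for s
    using that by (rule inv_into_into)
  then have "\<forall>s\<in>F ` I. nth_vderiv 1 (inv_into I F) s = inverse (f (inv_into I F s))"
    using inv(2) dF by simp
  with inv(1) show ?thesis by blast
qed

section \<open>Null coordinates and linear isometries\<close>

definition null_plus :: "real \<times> real \<Rightarrow> real" where "null_plus p = fst p + snd p"
definition null_minus :: "real \<times> real \<Rightarrow> real" where "null_minus p = fst p - snd p"

text \<open>Reflections exchange the two null coordinates. Statements about an ordered pair \<open>(f, g)\<close> of null
  coordinates cover a curve and its mirror image at once, as well as both ends of a curve.\<close>

definition null_pair :: "(real \<times> real \<Rightarrow> real) \<Rightarrow> (real \<times> real \<Rightarrow> real) \<Rightarrow> bool" where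
  "null_pair f g \<longleftrightarrow> (f = null_plus \<and> g = null_minus) \<or> (f = null_minus \<and> g = null_plus)"

lemma null_pair_cases:
  assumes "null_pair f g"
  obtains "f = null_plus" "g = null_minus" | "f = null_minus" "g = null_plus"
  using assms by (auto simp: null_pair_def)

lemma null_pair_std: "null_pair null_plus null_minus"
  by (simp add: null_pair_def)

lemma null_pair_sym: "null_pair f g \<Longrightarrow> null_pair g f"
  by (auto simp: null_pair_def)

lemma lprod_null_pair: "null_pair f g \<Longrightarrow> lprod p q = (f p * g q + g p * f q) / 2"
  by (erule null_pair_cases) (auto simp: lprod_def null_plus_def null_minus_def algebra_simps)

lemma lprod_self_null_pair: "null_pair f g \<Longrightarrow> lprod p p = f p * g p"
  by (simp add: lprod_null_pair)

lemma norm_null_pair: "null_pair f g \<Longrightarrow> (norm p)\<^sup>2 = ((f p)\<^sup>2 + (g p)\<^sup>2) / 2"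
  by (erule null_pair_cases; cases p)
     (auto simp: norm_Pair null_plus_def null_minus_def power2_eq_square algebra_simps)

lemma null_pair_linear:
  assumes "null_pair f g"
  shows "bounded_linear f"
  using assms
  by (rule null_pair_cases)
     (auto simp: null_plus_def[abs_def] null_minus_def[abs_def]
       intro!: bounded_linear_add bounded_linear_sub bounded_linear_fst bounded_linear_snd)

lemma null_pair_eqI:
  assumes "null_pair f g" "f p = f q" "g p = g q"
  shows "p = q"
  using assms(1)
  by (rule null_pair_cases)
     (use assms in \<open>auto simp: prod_eq_iff null_plus_def null_minus_def algebra_simps\<close>)

lemma null_pair_ex:
  assumes "null_pair f g"
  obtains p where "f p = a" "g p = b"
  using assms
proof (rule null_pair_cases)
  assume "f = null_plus" "g = null_minus"
  then show thesis by (intro that[of "((a + b) / 2, (a - b) / 2)"])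
      (simp_all add: null_plus_def null_minus_def field_simps)
next
  assume "f = null_minus" "g = null_plus"
  then show thesis by (intro that[of "((a + b) / 2, (b - a) / 2)"])
      (simp_all add: null_plus_def null_minus_def field_simps)
qed

lemma null_pair_vertical:
  assumes "null_pair f g"
  obtains e where "\<bar>e\<bar> = 1" "\<And>y. f (0, y) = e * y" "\<And>y. g (0, y) = - e * y"
  using assms
proof (rule null_pair_cases)
  assume "f = null_plus" "g = null_minus"
  then show thesis by (intro that[of 1]) (simp_all add: null_plus_def null_minus_def)
next
  assume "f = null_minus" "g = null_plus"
  then show thesis by (intro that[of "-1"]) (simp_all add: null_plus_def null_minus_def)
qed

text \<open>The two null directions \<open>p1\<close> and \<open>p2\<close> are sent to null directions. If the image of \<open>p1\<close> lies on the
  line \<open>g = 0\<close>, then the image of \<open>p2\<close>, not being orthogonal to it, lies on \<open>f = 0\<close>, and the product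
  of the two scaling factors is 1.\<close>

lemma linear_isometry_null_pair:
  assumes "linear_isometry L"
  obtains f g a where "null_pair f g" "a \<noteq> 0"
    "\<And>p. f (L p) = a * null_plus p" "\<And>p. g (L p) = null_minus p / a"
proof -
  define p1 p2 :: "real \<times> real" where "p1 = (1/2, 1/2)" and "p2 = (1/2, -1/2)"
  have lin: "linear L" and iso: "\<And>p q. lprod (L p) (L q) = lprod p q"
    using assms by (auto simp: linear_isometry_def)
  have decomp: "L p = null_plus p *\<^sub>R L p1 + null_minus p *\<^sub>R L p2" for p
  proof -
    have "p = null_plus p *\<^sub>R p1 + null_minus p *\<^sub>R p2"
      by (simp add: p1_def p2_def null_plus_def null_minus_def prod_eq_iff field_simps)
    then show ?thesis
      using linear_add[OF lin] linear_scale[OF lin] by metis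
  qed
  have "lprod p1 p1 = 0" "lprod p2 p2 = 0" "lprod p1 p2 = 1/2"
    by (simp_all add: lprod_def p1_def p2_def)
  then have "lprod (L p1) (L p1) = 0" "lprod (L p2) (L p2) = 0" "lprod (L p1) (L p2) = 1/2"
    by (simp_all add: iso)
  then have r: "null_plus (L p1) * null_minus (L p1) = 0"
    "null_plus (L p2) * null_minus (L p2) = 0"
    "null_plus (L p1) * null_minus (L p2) + null_minus (L p1) * null_plus (L p2) = 1"
    by (auto simp: lprod_null_pair[OF null_pair_std])
  note witness = that
  have main: thesis if fg: "null_pair f g" and z: "g (L p1) = 0" for f g
  proof -
    have l: "linear f" "linear g"
      using null_pair_linear fg null_pair_sym bounded_linear.linear by blast+
    have "f (L p1) * g (L p2) + g (L p1) * f (L p2) = 1 \<and> f (L p2) * g (L p2) = 0"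
      using fg
    proof (rule null_pair_cases)
      assume "f = null_plus" "g = null_minus"
      then show ?thesis using r by blast
    next
      assume "f = null_minus" "g = null_plus"
      then show ?thesis using r(2,3) by (simp only: mult.commute add.commute)
    qed
    then have one: "f (L p1) * g (L p2) = 1" and fg2: "f (L p2) * g (L p2) = 0"
      using z by simp_all
    from one have "f (L p1) \<noteq> 0" "g (L p2) \<noteq> 0" by auto
    then have "f (L p2) = 0" "g (L p2) = 1 / f (L p1)"
      using fg2 one by (auto simp: field_simps)
    then have "f (L p) = f (L p1) * null_plus p" "g (L p) = null_minus p / f (L p1)" for p
      using z by (subst decomp, simp add: linear_add[OF l(1)] linear_add[OF l(2)]
           linear_scale[OF l(1)] linear_scale[OF l(2)])+
    with fg \<open>f (L p1) \<noteq> 0\<close> show thesis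
      by (rule witness)
  qed
  show thesis
    using main[OF null_pair_std] main[OF null_pair_sym[OF null_pair_std]] r(1) by auto
qed

text \<open>A boost for \<open>a > 0\<close>, with rapidity \<open>ln a\<close>; for \<open>a < 0\<close> a boost composed with \<open>- id\<close>.\<close>

definition null_scaling :: "real \<Rightarrow> real \<times> real \<Rightarrow> real \<times> real" where
  "null_scaling a p =
     ((a * null_plus p + null_minus p / a) / 2, (a * null_plus p - null_minus p / a) / 2)"

lemma null_plus_scaling: "null_plus (null_scaling a p) = a * null_plus p"
  and null_minus_scaling: "null_minus (null_scaling a p) = null_minus p / a"
  unfolding null_scaling_def null_plus_def[of "(_, _)"] null_minus_def[of "(_, _)"]
  by (simp_all add: field_simps)

lemma linear_isometry_null_scaling:
  assumes "a \<noteq> 0"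
  shows "linear_isometry (null_scaling a)"
proof -
  have "linear (null_scaling a)"
    by (rule linearI)
       (use assms in \<open>simp_all add: null_scaling_def null_plus_def null_minus_def field_simps\<close>)
  moreover have "lprod (null_scaling a p) (null_scaling a q) = lprod p q" for p q
    using assms
    by (simp add: lprod_null_pair[of null_plus null_minus] null_pair_def
        null_plus_scaling null_minus_scaling)
  ultimately show ?thesis by (simp add: linear_isometry_def)
qed

section \<open>The stationarity equation\<close>

text \<open>The stationarity equation for position \<open>p\<close>, velocity \<open>q\<close> and acceleration \<open>a\<close> in an arbitrary
  parameter. Since \<open>null_minus q * null_plus a - null_plus q * null_minus a\<close> is twice the
  determinant of \<open>q\<close> and \<open>a\<close>, it reads
  \<open>det q a * lprod p p + \<alpha> * det q p * lprod q q = 0\<close>.\<close>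

definition stationary_eq ::
  "real \<Rightarrow> real \<times> real \<Rightarrow> real \<times> real \<Rightarrow> real \<times> real \<Rightarrow> bool" where
  "stationary_eq \<alpha> p q a \<longleftrightarrow>
     (null_minus q * null_plus a - null_plus q * null_minus a) * (null_plus p * null_minus p) +
     \<alpha> * (null_minus q * null_plus p - null_plus q * null_minus p) *
       (null_plus q * null_minus q) = 0"

lemma stationary_eq_null_pair:
  "null_pair f g \<Longrightarrow> stationary_eq \<alpha> p q a \<longleftrightarrow>
     (g q * f a - f q * g a) * (f p * g p) + \<alpha> * (g q * f p - f q * g p) * (f q * g q) = 0"
  unfolding stationary_eq_def by (erule null_pair_cases) (auto simp: algebra_simps)

text \<open>A change of parameter with derivatives \<open>k\<close> and \<open>l\<close> turns velocity and acceleration into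
  \<open>k *\<^sub>R q\<close> and \<open>k\<^sup>2 *\<^sub>R a + l *\<^sub>R q\<close>. The term with \<open>l\<close> drops out because the determinant is
  alternating, and both summands scale by \<open>k ^ 3\<close>.\<close>

lemma stationary_eq_reparametrize:
  assumes "k \<noteq> 0"
  shows "stationary_eq \<alpha> p (k *\<^sub>R q) (k\<^sup>2 *\<^sub>R a + l *\<^sub>R q) \<longleftrightarrow> stationary_eq \<alpha> p q a"
proof -
  let ?u = null_plus and ?v = null_minus
  have s: "?u (c *\<^sub>R x) = c * ?u x" "?v (c *\<^sub>R x) = c * ?v x"
    "?u (x + y) = ?u x + ?u y" "?v (x + y) = ?v x + ?v y" for c x y
    by (simp_all add: null_plus_def null_minus_def algebra_simps)
  have "(?v (k *\<^sub>R q) * ?u (k\<^sup>2 *\<^sub>R a + l *\<^sub>R q) - ?u (k *\<^sub>R q) * ?v (k\<^sup>2 *\<^sub>R a + l *\<^sub>R q)) * (?u p * ?v p) +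
     \<alpha> * (?v (k *\<^sub>R q) * ?u p - ?u (k *\<^sub>R q) * ?v p) * (?u (k *\<^sub>R q) * ?v (k *\<^sub>R q)) =
     k ^ 3 * ((?v q * ?u a - ?u q * ?v a) * (?u p * ?v p) +
     \<alpha> * (?v q * ?u p - ?u q * ?v p) * (?u q * ?v q))"
    unfolding s by (simp add: power2_eq_square power3_eq_cube algebra_simps)
  then show ?thesis
    using assms by (simp add: stationary_eq_def)
qed

text \<open>A normal \<open>N\<close> to \<open>q\<close> has null coordinates proportional to those of \<open>q\<close> with the sign of one of them
  changed, so \<open>lprod N x\<close> is a multiple of the determinant of \<open>q\<close> and \<open>x\<close>. The factor is nonzero and
  occurs on both sides of the curvature equation.\<close>

lemma curvature_equation_iff_stationary_eq:
  assumes "lprod q q = -1" "lprod N q = 0" "\<bar>lprod N N\<bar> = 1" "lprod p p > 0"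
  shows "- lprod N a = - \<alpha> * (lprod N p / \<bar>lprod p p\<bar>) \<longleftrightarrow> stationary_eq \<alpha> p q a"
proof -
  let ?u = null_plus and ?v = null_minus
  define k where "k = - ?u N * ?v q"
  have q: "?u q * ?v q = -1" and Nq: "?u N * ?v q + ?v N * ?u q = 0"
    using assms(1,2) by (simp_all add: lprod_null_pair[OF null_pair_std] mult.commute)
  have N: "?u N = k * ?u q" "?v N = - k * ?v q"
    using q Nq unfolding k_def by algebra+
  have "k \<noteq> 0"
    using assms(3) N by (auto simp: lprod_null_pair[OF null_pair_std])
  have Nx: "lprod N x = k / 2 * (?u q * ?v x - ?v q * ?u x)" for x
    by (simp add: lprod_null_pair[OF null_pair_std] N field_simps)
  have p: "\<bar>lprod p p\<bar> = ?u p * ?v p" "?u p * ?v p > 0"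
    using assms(4) by (simp_all add: lprod_null_pair[OF null_pair_std] mult.commute)
  have clear: "- (k / 2 * X) = - \<alpha> * (k / 2 * Y / P) \<longleftrightarrow> k / 2 * (X * P) = k / 2 * (\<alpha> * Y)"
    if "P > 0" for X Y P :: real
    using that by (auto simp: field_simps)
  have "- lprod N a = - \<alpha> * (lprod N p / \<bar>lprod p p\<bar>) \<longleftrightarrow>
      k / 2 * ((?u q * ?v a - ?v q * ?u a) * (?u p * ?v p)) =
      k / 2 * (\<alpha> * (?u q * ?v p - ?v q * ?u p))"
    unfolding Nx p(1) by (rule clear[OF p(2)])
  also have "\<dots> \<longleftrightarrow> (?u q * ?v a - ?v q * ?u a) * (?u p * ?v p) = \<alpha> * (?u q * ?v p - ?v q * ?u p)"
    using \<open>k \<noteq> 0\<close> by simp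
  also have "\<dots> \<longleftrightarrow> stationary_eq \<alpha> p q a"
    unfolding stationary_eq_def q by (auto simp: algebra_simps)
  finally show ?thesis .
qed

text \<open>The parameter-free form of \<open>stationary_timelike_in_cone_plus\<close> on which the integration works.\<close>

definition timelike_solution :: "real \<Rightarrow> real set \<Rightarrow> (real \<Rightarrow> real \<times> real) \<Rightarrow> bool" where
  "timelike_solution \<alpha> I \<gamma> \<longleftrightarrow> open_interval I \<and> smooth I \<gamma> \<and>
     (\<forall>t\<in>I. lprod (\<gamma> t) (\<gamma> t) > 0 \<and> lprod (nth_vderiv 1 \<gamma> t) (nth_vderiv 1 \<gamma> t) < 0 \<and>
        stationary_eq \<alpha> (\<gamma> t) (nth_vderiv 1 \<gamma> t) (nth_vderiv 2 \<gamma> t))"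

lemma nth_vderiv_reparametrize:
  assumes "change_of_parameter \<psi> J I" "smooth I \<gamma>" "s \<in> J"
  shows "nth_vderiv 1 (\<lambda>s. \<gamma> (\<psi> s)) s = nth_vderiv 1 \<psi> s *\<^sub>R nth_vderiv 1 \<gamma> (\<psi> s)"
    and "nth_vderiv 2 (\<lambda>s. \<gamma> (\<psi> s)) s =
      (nth_vderiv 1 \<psi> s)\<^sup>2 *\<^sub>R nth_vderiv 2 \<gamma> (\<psi> s) + nth_vderiv 2 \<psi> s *\<^sub>R nth_vderiv 1 \<gamma> (\<psi> s)"
proof -
  note c = change_of_parameter_derivative[OF assms(1)]
  have oI: "open I" using change_of_parameter_open_interval[OF assms(1)] by (simp add: open_interval_def)
  have d\<psi>: "(\<psi> has_vector_derivative nth_vderiv 1 \<psi> s) (at s)"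
    and d\<psi>2: "(nth_vderiv 1 \<psi> has_vector_derivative nth_vderiv 2 \<psi> s) (at s)"
    and im: "\<psi> s \<in> I" if "s \<in> J" for s
    using smooth_derivative(2,3)[OF c(4,1) that] c(5) that by auto
  have d1: "((\<lambda>s. \<gamma> (\<psi> s)) has_vector_derivative nth_vderiv 1 \<psi> s *\<^sub>R nth_vderiv 1 \<gamma> (\<psi> s)) (at s)"
    if "s \<in> J" for s
    using vector_diff_chain_at[OF d\<psi>[OF that] smooth_derivative(2)[OF assms(2) oI im[OF that]]]
    by (simp add: o_def)
  then show "nth_vderiv 1 (\<lambda>s. \<gamma> (\<psi> s)) s = nth_vderiv 1 \<psi> s *\<^sub>R nth_vderiv 1 \<gamma> (\<psi> s)"
    using assms(3) by (intro nth_vderiv_1_eq)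
  have "((\<lambda>s. nth_vderiv 1 \<gamma> (\<psi> s)) has_vector_derivative nth_vderiv 1 \<psi> s *\<^sub>R nth_vderiv 2 \<gamma> (\<psi> s)) (at s)"
    using vector_diff_chain_at[OF d\<psi>[OF assms(3)] smooth_derivative(3)[OF assms(2) oI im[OF assms(3)]]]
    by (simp add: o_def)
  then have "((\<lambda>s. nth_vderiv 1 \<psi> s *\<^sub>R nth_vderiv 1 \<gamma> (\<psi> s)) has_vector_derivative
      nth_vderiv 1 \<psi> s *\<^sub>R nth_vderiv 1 \<psi> s *\<^sub>R nth_vderiv 2 \<gamma> (\<psi> s) +
      nth_vderiv 2 \<psi> s *\<^sub>R nth_vderiv 1 \<gamma> (\<psi> s)) (at s)"
    using d\<psi>2[OF assms(3)]
    by (intro has_vector_derivative_scaleR) (simp_all add: has_real_derivative_iff_has_vector_derivative)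
  from nth_vderiv_2_eq[OF c(1) assms(3) d1 this]
  show "nth_vderiv 2 (\<lambda>s. \<gamma> (\<psi> s)) s =
      (nth_vderiv 1 \<psi> s)\<^sup>2 *\<^sub>R nth_vderiv 2 \<gamma> (\<psi> s) + nth_vderiv 2 \<psi> s *\<^sub>R nth_vderiv 1 \<gamma> (\<psi> s)"
    by (simp add: power2_eq_square)
qed

lemma lprod_scaleR: "lprod (k *\<^sub>R p) (k *\<^sub>R p) = k\<^sup>2 * lprod p p"
  by (simp add: lprod_def power2_eq_square algebra_simps)

lemma timelike_solution_reparametrize:
  assumes "change_of_parameter \<psi> J I" "timelike_solution \<alpha> I \<gamma>"
  shows "timelike_solution \<alpha> J (\<lambda>s. \<gamma> (\<psi> s))"
proof -
  note c = change_of_parameter_derivative[OF assms(1)]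
  have g: "smooth I \<gamma>" using assms(2) by (simp add: timelike_solution_def)
  have "smooth J (\<lambda>s. \<gamma> (\<psi> s))"
    by (rule smooth_compose[OF c(4) _ g]) (simp add: c(5))
  moreover have "\<psi> s \<in> I" if "s \<in> J" for s using c(5) that by auto
  ultimately show ?thesis
    using c(1-3) assms(2) c(6)
    by (auto simp: timelike_solution_def open_interval_def nth_vderiv_reparametrize[OF assms(1) g]
        stationary_eq_reparametrize lprod_scaleR mult_less_0_iff zero_less_power2)
qed

lemma timelike_solution_cong:
  assumes "timelike_solution \<alpha> I \<gamma>" "\<And>t. t \<in> I \<Longrightarrow> \<gamma> t = \<beta> t"
  shows "timelike_solution \<alpha> I \<beta>"
proof -
  have I: "open_interval I" "open I" "smooth I \<gamma>"
    using assms(1) by (auto simp: timelike_solution_def open_interval_def)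
  have d: "(\<beta> has_vector_derivative nth_vderiv 1 \<gamma> t) (at t)" if "t \<in> I" for t
    using smooth_derivative(2)[OF I(3,2) that] I(2) that assms(2)
    by (rule has_vector_derivative_transform_within_open)
  have "nth_vderiv 1 \<beta> t = nth_vderiv 1 \<gamma> t" "nth_vderiv 2 \<beta> t = nth_vderiv 2 \<gamma> t" if "t \<in> I" for t
    using nth_vderiv_1_eq[OF d[OF that]]
      nth_vderiv_2_eq[OF I(2) that d smooth_derivative(3)[OF I(3,2) that]] by auto
  moreover have "smooth I \<beta>" using smooth_cong[OF I(2) assms(2) I(3)] .
  ultimately show ?thesis using assms by (simp add: timelike_solution_def)
qed

text \<open>In one direction the equation is carried from the given arc-length parametrization to \<open>\<gamma>\<close>. In the
  other one such a parametrization is built from an antiderivative of the speed, and exchanging the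
  two components of its velocity gives a unit normal.\<close>

lemma stationary_iff_timelike_solution:
  "stationary_timelike_in_cone_plus \<alpha> I \<gamma> \<longleftrightarrow> timelike_solution \<alpha> I \<gamma>"
proof
  assume st: "stationary_timelike_in_cone_plus \<alpha> I \<gamma>"
  then have tl: "timelike_curve I \<gamma>" and cp: "\<And>t. t \<in> I \<Longrightarrow> lprod (\<gamma> t) (\<gamma> t) > 0"
    by (auto simp: stationary_timelike_in_cone_plus_def cone_plus_def)
  have I: "open_interval I" "smooth I \<gamma>"
    and neg: "\<And>t. t \<in> I \<Longrightarrow> lprod (nth_vderiv 1 \<gamma> t) (nth_vderiv 1 \<gamma> t) < 0"
    using tl by (auto simp: timelike_curve_def smooth_on_interval_iff)
  obtain J \<psi> N where c: "change_of_parameter \<psi> J I"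
    and al: "arc_length_parametrized J (\<lambda>s. \<gamma> (\<psi> s))"
    and N: "unit_normal_field J (\<lambda>s. \<gamma> (\<psi> s)) N"
    and eq: "\<forall>s\<in>J. arc_length_curvature (\<lambda>s. \<gamma> (\<psi> s)) N s =
           - \<alpha> * (lprod (N s) (\<gamma> (\<psi> s)) / \<bar>lprod (\<gamma> (\<psi> s)) (\<gamma> (\<psi> s))\<bar>)"
    using st unfolding stationary_timelike_in_cone_plus_def alpha_stationary_def o_def by blast
  note cd = change_of_parameter_derivative[OF c]
  have "stationary_eq \<alpha> (\<gamma> t) (nth_vderiv 1 \<gamma> t) (nth_vderiv 2 \<gamma> t)" if "t \<in> I" for t
  proof -
    obtain s where s: "s \<in> J" "t = \<psi> s" using \<open>t \<in> I\<close> cd(5) by auto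
    note d = nth_vderiv_reparametrize[OF c I(2) s(1)]
    have "lprod (nth_vderiv 1 (\<lambda>s. \<gamma> (\<psi> s)) s) (nth_vderiv 1 (\<lambda>s. \<gamma> (\<psi> s)) s) < 0"
      using neg[OF that] cd(6)[OF s(1)]
      by (simp add: d(1) lprod_scaleR mult_less_0_iff zero_less_power2 s(2))
    then have "lprod (nth_vderiv 1 (\<lambda>s. \<gamma> (\<psi> s)) s) (nth_vderiv 1 (\<lambda>s. \<gamma> (\<psi> s)) s) = -1"
      using al s(1) by (auto simp: arc_length_parametrized_def abs_if split: if_splits)
    then have "stationary_eq \<alpha> (\<gamma> (\<psi> s)) (nth_vderiv 1 (\<lambda>s. \<gamma> (\<psi> s)) s) (nth_vderiv 2 (\<lambda>s. \<gamma> (\<psi> s)) s)"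
      using curvature_equation_iff_stationary_eq[of _ "N s" "\<gamma> (\<psi> s)"] N eq s cp[OF that]
      unfolding unit_normal_field_def arc_length_curvature_def by blast
    then show ?thesis
      using cd(6)[OF s(1)] by (simp add: d stationary_eq_reparametrize s(2))
  qed
  then show "timelike_solution \<alpha> I \<gamma>"
    using I neg cp by (simp add: timelike_solution_def)
next
  assume sol: "timelike_solution \<alpha> I \<gamma>"
  then have I: "open_interval I" "smooth I \<gamma>" "open I"
    and neg: "\<And>t. t \<in> I \<Longrightarrow> lprod (nth_vderiv 1 \<gamma> t) (nth_vderiv 1 \<gamma> t) < 0"
    and pos: "\<And>t. t \<in> I \<Longrightarrow> lprod (\<gamma> t) (\<gamma> t) > 0"
    by (auto simp: timelike_solution_def open_interval_def)
  let ?w = "\<lambda>t. lprod (nth_vderiv 1 \<gamma> t) (nth_vderiv 1 \<gamma> t)"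
  define f where "f t = exp (1/2 * ln (- ?w t))" for t
  have f2: "(f t)\<^sup>2 = - ?w t" "f t > 0" if "t \<in> I" for t
    using neg[OF that] by (simp_all add: f_def power2_eq_square flip: exp_add)
  note comp = smooth_bounded_linear[OF bounded_linear_fst] smooth_bounded_linear[OF bounded_linear_snd]
  have "smooth I (\<lambda>t. (- 1) * (fst (nth_vderiv 1 \<gamma> t) * fst (nth_vderiv 1 \<gamma> t) +
      (- 1) * (snd (nth_vderiv 1 \<gamma> t) * snd (nth_vderiv 1 \<gamma> t))))"
    by (intro smooth_mult smooth_add smooth_const comp smooth_derivative(1) I)
  then have "smooth I (\<lambda>t. - ?w t)"
    by (simp add: lprod_def)
  then have "smooth I f"
    unfolding f_def using neg by (intro smooth_exp smooth_mult smooth_const smooth_ln) auto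
  then obtain \<psi> J where c: "change_of_parameter \<psi> J I"
    and \<psi>: "\<And>s. s \<in> J \<Longrightarrow> nth_vderiv 1 \<psi> s = inverse (f (\<psi> s))"
    using ex_change_of_parameter_with_speed[OF I(1)] f2(2) by metis
  note cd = change_of_parameter_derivative[OF c]
  define \<beta> where "\<beta> s = \<gamma> (\<psi> s)" for s
  have \<beta>: "timelike_solution \<alpha> J \<beta>"
    unfolding \<beta>_def[abs_def] by (rule timelike_solution_reparametrize[OF c sol])
  then have J: "open_interval J" "open J" "smooth J \<beta>"
    by (auto simp: timelike_solution_def open_interval_def)
  define N where "N s = (snd (nth_vderiv 1 \<beta> s), fst (nth_vderiv 1 \<beta> s))" for s
  have unit: "lprod (nth_vderiv 1 \<beta> s) (nth_vderiv 1 \<beta> s) = -1" if s: "s \<in> J" for s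
  proof -
    have "\<psi> s \<in> I" using s cd(5) by auto
    from f2[OF this] neg[OF this] show ?thesis
      unfolding \<beta>_def nth_vderiv_reparametrize(1)[OF c I(2) s] lprod_scaleR \<psi>[OF s]
      by (simp add: field_simps)
  qed
  have NN: "lprod (N s) (nth_vderiv 1 \<beta> s) = 0" "\<bar>lprod (N s) (N s)\<bar> = 1" if "s \<in> J" for s
    using unit[OF that] by (simp_all add: N_def lprod_def)
  have "smooth J N"
    unfolding N_def[abs_def] by (intro smooth_Pair comp smooth_derivative(1) J)
  then have "unit_normal_field J \<beta> N"
    using NN J(1) by (simp add: unit_normal_field_def smooth_on_interval_iff)
  moreover have "arc_length_parametrized J \<beta>"
    by (simp add: arc_length_parametrized_def unit)
  moreover have "arc_length_curvature \<beta> N s = - \<alpha> * (lprod (N s) (\<beta> s) / \<bar>lprod (\<beta> s) (\<beta> s)\<bar>)"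
    if "s \<in> J" for s
    unfolding arc_length_curvature_def
    by (rule curvature_equation_iff_stationary_eq[OF unit[OF that] NN[OF that], THEN iffD2])
       (use \<beta> that in \<open>auto simp: timelike_solution_def\<close>)
  moreover have "timelike_curve I \<gamma>"
    using I neg by (simp add: timelike_curve_def smooth_on_interval_iff)
  moreover have "\<gamma> ` I \<subseteq> cone_plus" "\<gamma> ` I \<inter> light_cone = {}"
    using pos by (auto simp: cone_plus_def light_cone_def) (metis less_irrefl)
  ultimately show "stationary_timelike_in_cone_plus \<alpha> I \<gamma>"
    unfolding stationary_timelike_in_cone_plus_def alpha_stationary_def o_def
    using c unfolding \<beta>_def[abs_def] by blast
qed

section \<open>Model curves\<close>

text \<open>The derivative of \<open>ln (rho \<alpha> c s)\<close> with respect to \<open>s\<close>.\<close>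

definition log_slope :: "real \<Rightarrow> real \<Rightarrow> real \<Rightarrow> real" where
  "log_slope \<alpha> c s = (if \<alpha> \<noteq> 1 then tanh ((\<alpha> - 1) * s) else c)"

lemma rho_exp: "rho \<alpha> c s = exp (if \<alpha> \<noteq> 1 then ln (cosh ((\<alpha> - 1) * s)) / (\<alpha> - 1) else c * s)"
  using cosh_real_pos[of "(\<alpha> - 1) * s"] by (auto simp: rho_def powr_def less_le)

lemma rho_pos: "rho \<alpha> c s > 0"
  by (simp add: rho_exp)

lemma DERIV_ln_rho: "((\<lambda>s. ln (rho \<alpha> c s)) has_real_derivative log_slope \<alpha> c s) (at s)"
proof (cases "\<alpha> = 1")
  case False
  have "cosh ((\<alpha> - 1) * s) > 0" by (rule cosh_real_pos)
  with False show ?thesis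
    by (auto simp: rho_exp log_slope_def tanh_def intro!: derivative_eq_intros)
qed (auto simp: rho_exp log_slope_def intro!: derivative_eq_intros)

lemma DERIV_rho: "(rho \<alpha> c has_real_derivative rho \<alpha> c s * log_slope \<alpha> c s) (at s)"
  using DERIV_fun_exp[OF DERIV_ln_rho, of \<alpha> c s] rho_pos[of \<alpha> c] by simp

lemma DERIV_log_slope:
  "(log_slope \<alpha> c has_real_derivative (\<alpha> - 1) * (1 - (log_slope \<alpha> c s)\<^sup>2)) (at s)"
proof (cases "\<alpha> = 1")
  case False
  have "cosh ((\<alpha> - 1) * s) \<noteq> 0" using cosh_real_pos[of "(\<alpha> - 1) * s"] by simp
  with False show ?thesis
    by (auto simp: log_slope_def[abs_def] intro!: derivative_eq_intros)
qed (simp add: log_slope_def[abs_def])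

lemma abs_log_slope_less_1: "admissible \<alpha> c \<Longrightarrow> \<bar>log_slope \<alpha> c s\<bar> < 1"
  using tanh_real_bounds[of "(\<alpha> - 1) * s"] by (auto simp: admissible_def log_slope_def abs_less_iff)

lemma null_plus_model: "null_plus (model_curve \<alpha> c s) = rho \<alpha> c s * exp s"
  and null_minus_model: "null_minus (model_curve \<alpha> c s) = rho \<alpha> c s * exp (- s)"
  by (simp_all add: model_curve_def null_plus_def null_minus_def cosh_plus_sinh cosh_minus_sinh
      flip: distrib_left right_diff_distrib)

section \<open>Integrating the equation\<close>

text \<open>The \<open>s\<close> in \<open>r *\<^sub>R (cosh s, sinh s)\<close>, for every \<open>r \<noteq> 0\<close>.\<close>

definition hyperbolic_angle :: "real \<times> real \<Rightarrow> real" where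
  "hyperbolic_angle p = ln (null_plus p / null_minus p) / 2"

lemma DERIV_ln_quotient:
  assumes "(f has_real_derivative f') (at t)" "(g has_real_derivative g') (at t)" "f t * g t > 0"
  shows "((\<lambda>t. ln (f t / g t)) has_real_derivative f' / f t - g' / g t) (at t)"
proof -
  have "f t / g t > 0" "f t \<noteq> 0" "g t \<noteq> 0"
    using assms(3) by (auto simp: zero_less_mult_iff zero_less_divide_iff)
  then show ?thesis
    by (auto intro!: derivative_eq_intros assms(1,2) simp: field_simps)
qed

lemma DERIV_ln_product:
  assumes "(f has_real_derivative f') (at t)" "(g has_real_derivative g') (at t)" "f t * g t > 0"
  shows "((\<lambda>t. ln (f t * g t)) has_real_derivative f' / f t + g' / g t) (at t)"
proof -
  have "f t \<noteq> 0" "g t \<noteq> 0"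
    using assms(3) by auto
  then show ?thesis
    using assms(3) by (auto intro!: derivative_eq_intros assms(1,2) simp: field_simps)
qed

text \<open>Both coordinates have the same sign, and up to this sign they are recovered from the logarithmic
  radius and the hyperbolic angle.\<close>

lemma null_coordinates_from_ln:
  fixes u v :: real
  assumes "u * v > 0"
  shows "u = sgn u * exp (ln (u * v) / 2 + ln (u / v) / 2)"
    and "v = sgn u * exp (ln (u * v) / 2 - ln (u / v) / 2)"
proof -
  have p: "exp (ln (a * b) / 2 + ln (a / b) / 2) = a \<and> exp (ln (a * b) / 2 - ln (a / b) / 2) = b"
    if "a > 0" "b > 0" for a b :: real
    using that by (simp add: ln_mult ln_div field_simps flip: add_divide_distrib diff_divide_distrib)
  have "u > 0 \<and> v > 0 \<or> u < 0 \<and> v < 0" using assms by (simp add: zero_less_mult_iff)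
  then show "u = sgn u * exp (ln (u * v) / 2 + ln (u / v) / 2)"
    "v = sgn u * exp (ln (u * v) / 2 - ln (u / v) / 2)"
    using p[of u v] p[of "-u" "-v"] by auto
qed

lemma nonzero_sgn_constant:
  fixes f :: "real \<Rightarrow> real"
  assumes "is_interval I" "continuous_on I f" "\<And>t. t \<in> I \<Longrightarrow> f t \<noteq> 0" "x \<in> I" "y \<in> I"
  shows "sgn (f x) = sgn (f y)"
proof -
  have int: "is_interval (f ` I)"
    using connected_continuous_image[OF assms(2)] assms(1) is_interval_connected_1 by blast
  have "\<not> (f a < 0 \<and> 0 < f b)" if "a \<in> I" "b \<in> I" for a b
  proof
    assume "f a < 0 \<and> 0 < f b"
    then have "0 \<in> f ` I"
      using mem_is_interval_1_I[OF int, of "f a" "f b" 0] that by simp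
    then show False using assms(3) by auto
  qed
  from this[OF assms(4,5)] this[OF assms(5,4)] assms(3)[OF assms(4)] assms(3)[OF assms(5)]
  show ?thesis by (auto simp: sgn_if)
qed

lemma constant_on_interval:
  fixes f :: "real \<Rightarrow> real"
  assumes "is_interval I" "\<And>t. t \<in> I \<Longrightarrow> (f has_real_derivative 0) (at t)"
  shows "\<exists>k. \<forall>t\<in>I. f t = k"
proof -
  have "convex I" using assms(1) by (rule is_interval_convex)
  from has_field_derivative_zero_constant[OF this] assms(2)
  show ?thesis by (blast intro: has_field_derivative_at_within)
qed

lemma null_coordinate_derivatives:
  assumes "smooth I \<gamma>" "open I" "t \<in> I" "null_pair f g"
  shows "((\<lambda>t. f (\<gamma> t)) has_real_derivative f (nth_vderiv 1 \<gamma> t)) (at t)"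
    and "((\<lambda>t. f (nth_vderiv 1 \<gamma> t)) has_real_derivative f (nth_vderiv 2 \<gamma> t)) (at t)"
  using bounded_linear.has_vector_derivative[OF null_pair_linear[OF assms(4)]]
    smooth_derivative(2,3)[OF assms(1-3)]
  by (simp_all add: has_real_derivative_iff_has_vector_derivative)

text \<open>Here \<open>u'/u\<close> and \<open>v'/v\<close> have opposite signs because \<open>u * v > 0\<close> and \<open>u' * v' < 0\<close>; hence their
  difference does not vanish, and the hyperbolic angle is a regular parameter.\<close>

lemma hyperbolic_angle_parameter:
  assumes "open_interval I" "smooth I \<gamma>" "\<And>t. t \<in> I \<Longrightarrow> lprod (\<gamma> t) (\<gamma> t) > 0"
    "\<And>t. t \<in> I \<Longrightarrow> lprod (nth_vderiv 1 \<gamma> t) (nth_vderiv 1 \<gamma> t) < 0"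
  defines "h \<equiv> \<lambda>t. hyperbolic_angle (\<gamma> t)"
  defines "h' \<equiv> \<lambda>t. (null_plus (nth_vderiv 1 \<gamma> t) / null_plus (\<gamma> t) -
                    null_minus (nth_vderiv 1 \<gamma> t) / null_minus (\<gamma> t)) / 2"
  shows "t \<in> I \<Longrightarrow> (h has_real_derivative h' t) (at t)"
    and "t \<in> I \<Longrightarrow> h' t \<noteq> 0"
    and "smooth I h"
proof -
  let ?U = "\<lambda>t. null_plus (\<gamma> t)" and ?V = "\<lambda>t. null_minus (\<gamma> t)"
  let ?U1 = "\<lambda>t. null_plus (nth_vderiv 1 \<gamma> t)" and ?V1 = "\<lambda>t. null_minus (nth_vderiv 1 \<gamma> t)"
  note std = null_pair_std null_pair_sym[OF null_pair_std]
  have I: "open I" using assms(1) by (simp add: open_interval_def)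
  have pos: "?U t * ?V t > 0" and neg: "?U1 t * ?V1 t < 0" if "t \<in> I" for t
    using assms(3,4)[OF that] by (simp_all add: lprod_self_null_pair[OF std(1)])
  note d = null_coordinate_derivatives(1)[OF assms(2) I]
  show "(h has_real_derivative h' t) (at t)" if "t \<in> I" for t
    unfolding h_def h'_def hyperbolic_angle_def
    by (intro DERIV_cdivide DERIV_ln_quotient d[OF _ std(1)] d[OF _ std(2)] that pos)
  show "h' t \<noteq> 0" if "t \<in> I" for t
  proof
    assume "h' t = 0"
    moreover have "?U t \<noteq> 0" "?V t \<noteq> 0" using pos[OF that] by auto
    ultimately have "?U1 t * ?V t = ?U t * ?V1 t"
      by (simp add: h'_def field_simps)
    then have "(?U1 t * ?V1 t) * (?V t)\<^sup>2 = (?U t * ?V t) * (?V1 t)\<^sup>2"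
      by (simp add: power2_eq_square algebra_simps)
    moreover have "(?U1 t * ?V1 t) * (?V t)\<^sup>2 < 0"
      using pos[OF that] by (intro mult_neg_pos neg that) auto
    moreover have "(?U t * ?V t) * (?V1 t)\<^sup>2 \<ge> 0"
      using pos[OF that] by simp
    ultimately show False by linarith
  qed
  have "?V t \<noteq> 0" "?U t * inverse (?V t) > 0" if "t \<in> I" for t
    using pos[OF that] by (auto simp: zero_less_mult_iff)
  then have "smooth I (\<lambda>t. ln (?U t * inverse (?V t)) * (1/2))"
    by (intro smooth_mult smooth_const smooth_ln smooth_inverse
        smooth_bounded_linear[OF null_pair_linear[OF std(1)]]
        smooth_bounded_linear[OF null_pair_linear[OF std(2)]] assms(2))
  then show "smooth I h"
    unfolding h_def hyperbolic_angle_def by (simp only: divide_inverse mult_1)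
qed

text \<open>Integration of the equation: the velocity turns \<open>\<alpha>\<close> times as fast as the position, and the
  hyperbolic tangent of the angle between them is the logarithmic slope of the radius.\<close>

lemma timelike_solution_is_model:
  assumes sol: "timelike_solution \<alpha> I \<gamma>"
  shows "\<exists>L r c \<phi> K. linear_isometry L \<and> r > 0 \<and> admissible \<alpha> c \<and>
           change_of_parameter \<phi> I K \<and> (\<forall>t\<in>I. \<gamma> t = r *\<^sub>R L (model_curve \<alpha> c (\<phi> t)))"
proof -
  have I: "open_interval I" "smooth I \<gamma>" "open I" "is_interval I" "I \<noteq> {}"
    and neg0: "\<And>t. t \<in> I \<Longrightarrow> lprod (nth_vderiv 1 \<gamma> t) (nth_vderiv 1 \<gamma> t) < 0"
    and pos0: "\<And>t. t \<in> I \<Longrightarrow> lprod (\<gamma> t) (\<gamma> t) > 0"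
    using sol by (auto simp: timelike_solution_def open_interval_def)
  define U V U1 V1 U2 V2 where "U t = null_plus (\<gamma> t)" and "V t = null_minus (\<gamma> t)"
    and "U1 t = null_plus (nth_vderiv 1 \<gamma> t)" and "V1 t = null_minus (nth_vderiv 1 \<gamma> t)"
    and "U2 t = null_plus (nth_vderiv 2 \<gamma> t)" and "V2 t = null_minus (nth_vderiv 2 \<gamma> t)" for t
  note UV_defs = U_def[abs_def] V_def[abs_def] U1_def[abs_def] V1_def[abs_def]
    U2_def[abs_def] V2_def[abs_def]
  have d: "(U has_real_derivative U1 t) (at t)" "(V has_real_derivative V1 t) (at t)"
    "(U1 has_real_derivative U2 t) (at t)" "(V1 has_real_derivative V2 t) (at t)" if "t \<in> I" for t
    unfolding UV_defs
    using null_coordinate_derivatives[OF I(2,3) that] null_pair_std null_pair_sym by blast+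
  have pos: "U t * V t > 0" and neg: "U1 t * V1 t < 0" if "t \<in> I" for t
    using pos0[OF that] neg0[OF that] by (simp_all add: UV_defs lprod_self_null_pair[OF null_pair_std])
  have eq: "(V1 t * U2 t - U1 t * V2 t) * (U t * V t) +
      \<alpha> * (V1 t * U t - U1 t * V t) * (U1 t * V1 t) = 0" if "t \<in> I" for t
    using sol that by (simp add: timelike_solution_def stationary_eq_def UV_defs)
  \<comment> \<open>Angle of the position and its derivative, angle of the velocity, logarithm of the radius.\<close>
  define h h' B R where "h t = hyperbolic_angle (\<gamma> t)" and "h' t = (U1 t / U t - V1 t / V t) / 2"
    and "B t = ln (U1 t / (- V1 t)) / 2" and "R t = ln (U t * V t) / 2" for t
  have dh: "(h has_real_derivative h' t) (at t)" and h'0: "h' t \<noteq> 0" and sh: "smooth I h"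
    if "t \<in> I" for t
    unfolding h_def[abs_def] h'_def UV_defs
    using hyperbolic_angle_parameter[OF I(1,2) pos0 neg0] that by auto
  have dB: "(B has_real_derivative (U2 t / U1 t - V2 t / V1 t) / 2) (at t)" if t: "t \<in> I" for t
  proof -
    have "(B has_real_derivative (U2 t / U1 t - (- V2 t) / (- V1 t)) / 2) (at t)"
      unfolding B_def[abs_def]
      using neg[OF t] by (intro DERIV_cdivide DERIV_ln_quotient DERIV_minus d t) simp
    then show ?thesis by simp
  qed
  have dR: "(R has_real_derivative (U1 t / U t + V1 t / V t) / 2) (at t)" if t: "t \<in> I" for t
    unfolding R_def[abs_def] by (intro DERIV_cdivide DERIV_ln_product d t pos)
  have B': "(U2 t / U1 t - V2 t / V1 t) / 2 = \<alpha> * h' t" if t: "t \<in> I" for t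
  proof -
    have nz: "U t \<noteq> 0" "V t \<noteq> 0" "U1 t \<noteq> 0" "V1 t \<noteq> 0"
      using pos[OF t] neg[OF t] by auto
    \<comment> \<open>The equation divided by \<open>2 * u * v * u' * v'\<close>.\<close>
    have "(U2 t / U1 t - V2 t / V1 t) / 2 - \<alpha> * h' t =
      ((V1 t * U2 t - U1 t * V2 t) * (U t * V t) +
      \<alpha> * (V1 t * U t - U1 t * V t) * (U1 t * V1 t)) / (2 * U t * V t * U1 t * V1 t)"
      using nz unfolding h'_def by (simp add: field_simps)
    then show ?thesis using eq[OF t] by simp
  qed
  have "((\<lambda>t. B t - \<alpha> * h t) has_real_derivative 0) (at t)" if t: "t \<in> I" for t
    using DERIV_diff[OF dB[OF t] DERIV_cmult[OF dh[OF t], of \<alpha>]] B'[OF t] by simp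
  from constant_on_interval[OF I(4) this]
  obtain e0 where e0: "B t = \<alpha> * h t + e0" if "t \<in> I" for t
    by (auto simp: algebra_simps)
  \<comment> \<open>With \<open>a = u'/u\<close> and \<open>b = v'/v\<close>, \<open>exp (2 * (B - h)) = - a / b\<close>, hence \<open>tanh (B - h) = (a + b) / (a - b)\<close>.\<close>
  have tanh_eq: "tanh (B t - h t) * h' t = (U1 t / U t + V1 t / V t) / 2" if t: "t \<in> I" for t
  proof -
    define a b where "a = U1 t / U t" and "b = V1 t / V t"
    have nz: "U t \<noteq> 0" "V t \<noteq> 0" "U1 t \<noteq> 0" "V1 t \<noteq> 0"
      using pos[OF t] neg[OF t] by auto
    have "U1 t / (- V1 t) > 0" "U t / V t > 0"
      using pos[OF t] neg[OF t]
      by (auto simp: zero_less_mult_iff mult_less_0_iff zero_less_divide_iff divide_less_0_iff)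
    then have "exp (2 * (B t - h t)) = (U1 t / (- V1 t)) / (U t / V t)"
      by (simp add: B_def h_def hyperbolic_angle_def exp_diff right_diff_distrib flip: U_def V_def)
    also have "\<dots> = - a / b"
      using nz by (simp add: a_def b_def field_simps)
    finally have E: "exp (2 * (B t - h t)) = - a / b" .
    have "b \<noteq> 0" "a - b \<noteq> 0" using nz h'0[OF t] by (auto simp: a_def b_def h'_def)
    have "tanh (B t - h t) = (1 - exp (- 2 * (B t - h t))) / (1 + exp (- 2 * (B t - h t)))"
      by (rule tanh_real_altdef)
    also have "exp (- 2 * (B t - h t)) = inverse (- a / b)"
      unfolding E[symmetric] exp_minus[symmetric] by simp
    also have "(1 - inverse (- a / b)) / (1 + inverse (- a / b)) = (a + b) / (a - b)"
      using \<open>b \<noteq> 0\<close> \<open>a - b \<noteq> 0\<close> nz by (auto simp: a_def divide_simps) (auto simp: b_def field_simps)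
    finally show ?thesis
      using \<open>a - b \<noteq> 0\<close> by (simp add: h'_def flip: a_def b_def)
  qed
  \<comment> \<open>For \<open>\<alpha> \<noteq> 1\<close> a shift of \<open>h\<close> absorbs the constant; for \<open>\<alpha> = 1\<close> it becomes \<open>c\<close>.\<close>
  obtain c e where c: "admissible \<alpha> c" and slope: "log_slope \<alpha> c (h t + e) = tanh (B t - h t)"
    if "t \<in> I" for t
  proof (cases "\<alpha> = 1")
    case True
    have "admissible \<alpha> (tanh e0)"
      using tanh_real_bounds[of e0] by (auto simp: admissible_def abs_less_iff)
    then show thesis
      by (rule that[of "tanh e0" 0]) (simp add: e0 True log_slope_def)
  next
    case False
    have "admissible \<alpha> 0" by (simp add: admissible_def)
    then show thesis
      by (rule that[of 0 "e0 / (\<alpha> - 1)"])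
         (use False in \<open>simp add: e0 log_slope_def field_simps\<close>)
  qed
  have "((\<lambda>t. R t - ln (rho \<alpha> c (h t + e))) has_real_derivative 0) (at t)" if t: "t \<in> I" for t
  proof -
    have "((\<lambda>t. h t + e) has_real_derivative h' t) (at t)"
      using DERIV_add[OF dh[OF t] DERIV_const[of e]] by simp
    from DERIV_diff[OF dR[OF t] DERIV_chain2[OF DERIV_ln_rho this]]
    have "((\<lambda>t. R t - ln (rho \<alpha> c (h t + e))) has_real_derivative
        (U1 t / U t + V1 t / V t) / 2 - log_slope \<alpha> c (h t + e) * h' t) (at t)" .
    then show ?thesis by (simp only: slope[OF t] tanh_eq[OF t] diff_self)
  qed
  from constant_on_interval[OF I(4) this]
  obtain k where "\<And>t. t \<in> I \<Longrightarrow> R t = ln (rho \<alpha> c (h t + e)) + k"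
    by (auto simp: algebra_simps)
  then have k: "exp (R t) = exp k * rho \<alpha> c (h t + e)" if "t \<in> I" for t
    using that rho_pos by (simp add: exp_add)
  obtain t0 where "t0 \<in> I" using I(5) by blast
  define s where "s = sgn (U t0)"
  have "continuous_on I U"
    using d(1) DERIV_isCont by (intro continuous_at_imp_continuous_on) auto
  moreover have "U t \<noteq> 0" if "t \<in> I" for t using pos[OF that] by auto
  ultimately have s: "sgn (U t) = s" if "t \<in> I" for t
    unfolding s_def using nonzero_sgn_constant[OF I(4)] that \<open>t0 \<in> I\<close> by blast
  have "U t0 \<noteq> 0" using pos[OF \<open>t0 \<in> I\<close>] by auto
  then have ss: "s * s = 1" "s \<noteq> 0" unfolding s_def by (auto simp: sgn_if)
  have UV: "U t = s * (exp (R t) * exp (h t))" "V t = s * (exp (R t) * exp (- h t))" if "t \<in> I" for t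
  proof -
    have h: "h t = ln (U t / V t) / 2"
      by (simp add: h_def hyperbolic_angle_def U_def V_def)
    have "U t = s * exp (R t + h t)" "V t = s * exp (R t - h t)"
      unfolding R_def h s[OF that, symmetric]
      by (rule null_coordinates_from_ln[OF pos[OF that]])+
    then show "U t = s * (exp (R t) * exp (h t))" "V t = s * (exp (R t) * exp (- h t))"
      by (simp_all add: exp_add exp_diff exp_minus divide_inverse)
  qed
  \<comment> \<open>The boost undoes the shift \<open>e\<close>, and \<open>s\<close> selects the component of \<open>cone_plus\<close>.\<close>
  let ?L = "null_scaling (s * exp (- e))"
  have "linear_isometry ?L" using ss by (intro linear_isometry_null_scaling) simp
  moreover have "change_of_parameter (\<lambda>t. h t + e) I ((\<lambda>t. h t + e) ` I)"
  proof -
    have "((\<lambda>t. h t + e) has_vector_derivative h' t) (at t)" if t: "t \<in> I" for t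
      using DERIV_add[OF dh[OF t] DERIV_const[of e]]
      by (simp add: has_real_derivative_iff_has_vector_derivative)
    then show ?thesis
      using I(1) sh[OF \<open>t0 \<in> I\<close>] h'0 nth_vderiv_1_eq
      by (fastforce simp: change_of_parameter_def smooth_on_interval_iff intro: smooth_add smooth_const)
  qed
  moreover have "\<gamma> t = exp k *\<^sub>R ?L (model_curve \<alpha> c (h t + e))" if t: "t \<in> I" for t
  proof (rule null_pair_eqI[OF null_pair_std])
    have lin: "null_plus (a *\<^sub>R p) = a * null_plus p" "null_minus (a *\<^sub>R p) = a * null_minus p" for a p
      by (simp_all add: null_plus_def null_minus_def algebra_simps)
    have "exp (- e) * exp e = 1" by (simp flip: exp_add)
    then show "null_plus (\<gamma> t) = null_plus (exp k *\<^sub>R ?L (model_curve \<alpha> c (h t + e)))"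
      using UV(1)[OF t] k[OF t]
      by (simp add: U_def lin null_plus_scaling null_plus_model exp_add)
    show "null_minus (\<gamma> t) = null_minus (exp k *\<^sub>R ?L (model_curve \<alpha> c (h t + e)))"
      using UV(2)[OF t] k[OF t] ss
      by (simp add: V_def lin null_minus_scaling null_minus_model exp_minus exp_diff field_simps)
  qed
  ultimately show ?thesis
    using c[OF \<open>t0 \<in> I\<close>] by (intro exI[of _ ?L] exI[of _ "exp k"] exI[of _ c]
      exI[of _ "\<lambda>t. h t + e"] exI conjI ballI) auto
qed

section \<open>Images of model curves\<close>

definition model_velocity :: "real \<Rightarrow> real \<Rightarrow> real \<Rightarrow> real \<times> real" where
  "model_velocity \<alpha> c s = rho \<alpha> c s *\<^sub>R
     (log_slope \<alpha> c s * cosh s + sinh s, log_slope \<alpha> c s * sinh s + cosh s)"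

text \<open>The derivative of \<open>w = log_slope \<alpha> c s\<close> is \<open>(\<alpha> - 1) * (1 - w\<^sup>2)\<close>, which accounts for the first
  term of \<open>k\<close>.\<close>

definition model_acceleration :: "real \<Rightarrow> real \<Rightarrow> real \<Rightarrow> real \<times> real" where
  "model_acceleration \<alpha> c s = (let w = log_slope \<alpha> c s; k = (\<alpha> - 1) * (1 - w\<^sup>2) + w\<^sup>2 + 1 in
     rho \<alpha> c s *\<^sub>R (k * cosh s + 2 * w * sinh s, k * sinh s + 2 * w * cosh s))"

lemma model_curve_derivative:
  "(model_curve \<alpha> c has_vector_derivative model_velocity \<alpha> c s) (at s)"
  unfolding model_curve_def[abs_def] model_velocity_def scaleR_Pair
  by (rule has_vector_derivative_Pair; unfold has_real_derivative_iff_has_vector_derivative[symmetric])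
     (auto intro!: derivative_eq_intros DERIV_rho simp: algebra_simps)

lemma model_velocity_derivative:
  "(model_velocity \<alpha> c has_vector_derivative model_acceleration \<alpha> c s) (at s)"
  unfolding model_velocity_def[abs_def] model_acceleration_def Let_def scaleR_Pair
  by (rule has_vector_derivative_Pair; unfold has_real_derivative_iff_has_vector_derivative[symmetric])
     (auto intro!: derivative_eq_intros DERIV_rho DERIV_log_slope simp: algebra_simps power2_eq_square)

lemma null_plus_cosh_sinh: "null_plus (r *\<^sub>R (a * cosh s + b * sinh s, a * sinh s + b * cosh s)) = r * (a + b) * exp s"
  and null_minus_cosh_sinh: "null_minus (r *\<^sub>R (a * cosh s + b * sinh s, a * sinh s + b * cosh s)) = r * (a - b) * exp (- s)"
  by (simp_all add: null_plus_def null_minus_def algebra_simps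
      flip: cosh_plus_sinh[of s] cosh_minus_sinh[of s])

lemma null_plus_model_velocity:
    "null_plus (model_velocity \<alpha> c s) = rho \<alpha> c s * (log_slope \<alpha> c s + 1) * exp s"
  and null_minus_model_velocity:
    "null_minus (model_velocity \<alpha> c s) = rho \<alpha> c s * (log_slope \<alpha> c s - 1) * exp (- s)"
  using null_plus_cosh_sinh[of _ _ s 1] null_minus_cosh_sinh[of _ _ s 1]
  by (simp_all add: model_velocity_def)

lemma null_plus_model_acceleration:
    "null_plus (model_acceleration \<alpha> c s) = rho \<alpha> c s *
       ((\<alpha> - 1) * (1 - (log_slope \<alpha> c s)\<^sup>2) + (log_slope \<alpha> c s + 1)\<^sup>2) * exp s"
  and null_minus_model_acceleration:
    "null_minus (model_acceleration \<alpha> c s) = rho \<alpha> c s *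
       ((\<alpha> - 1) * (1 - (log_slope \<alpha> c s)\<^sup>2) + (log_slope \<alpha> c s - 1)\<^sup>2) * exp (- s)"
  unfolding model_acceleration_def Let_def null_plus_cosh_sinh null_minus_cosh_sinh
  by (simp_all add: power2_eq_square algebra_simps)

lemma smooth_rho: "smooth UNIV (rho \<alpha> c)"
proof (cases "\<alpha> = 1")
  case True
  have "smooth UNIV (\<lambda>s. exp (c * s))"
    by (intro smooth_exp smooth_mult smooth_const smooth_id)
  then show ?thesis using True by (simp add: rho_def[abs_def])
next
  case False
  have "smooth UNIV (\<lambda>s. exp (inverse (\<alpha> - 1) *
      ln ((1/2) * (exp ((\<alpha> - 1) * s) + exp ((- (\<alpha> - 1)) * s)))))"
    by (intro smooth_exp smooth_mult smooth_add smooth_ln smooth_const smooth_id)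
       (simp add: add_pos_pos)
  then show ?thesis
    by (rule smooth_cong[rotated 2])
       (use False in \<open>auto simp: rho_exp cosh_def field_simps\<close>)
qed

lemma smooth_model_curve: "smooth UNIV (model_curve \<alpha> c)"
proof -
  have "smooth UNIV (\<lambda>s. rho \<alpha> c s *\<^sub>R
      ((1/2) * (exp s + exp ((-1) * s)), (1/2) * (exp s + (-1) * exp ((-1) * s))))"
    by (intro smooth_scaleR smooth_rho smooth_Pair smooth_mult smooth_add smooth_exp
        smooth_const smooth_id)
  then show ?thesis
    by (simp add: model_curve_def[abs_def] cosh_def sinh_def)
qed

text \<open>All later computations on \<open>r *\<^sub>R L (model_curve \<alpha> c s)\<close> go through these formulas, in which the
  isometry and the dilation have shrunk to the constant factors \<open>r * a\<close> and \<open>r / a\<close>.\<close>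

lemma model_image_null_coordinates:
  fixes \<alpha> c :: real
  assumes "linear_isometry L" "r > 0"
  defines "\<gamma> \<equiv> \<lambda>s. r *\<^sub>R L (model_curve \<alpha> c s)"
  obtains f g a where "null_pair f g" "a \<noteq> 0"
    "\<And>s. f (\<gamma> s) = r * a * (rho \<alpha> c s * exp s)"
    "\<And>s. g (\<gamma> s) = r / a * (rho \<alpha> c s * exp (- s))"
    "\<And>s. f (nth_vderiv 1 \<gamma> s) = r * a * (rho \<alpha> c s * (log_slope \<alpha> c s + 1) * exp s)"
    "\<And>s. g (nth_vderiv 1 \<gamma> s) = r / a * (rho \<alpha> c s * (log_slope \<alpha> c s - 1) * exp (- s))"
    "\<And>s. f (nth_vderiv 2 \<gamma> s) = r * a * (rho \<alpha> c s *
        ((\<alpha> - 1) * (1 - (log_slope \<alpha> c s)\<^sup>2) + (log_slope \<alpha> c s + 1)\<^sup>2) * exp s)"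
    "\<And>s. g (nth_vderiv 2 \<gamma> s) = r / a * (rho \<alpha> c s *
        ((\<alpha> - 1) * (1 - (log_slope \<alpha> c s)\<^sup>2) + (log_slope \<alpha> c s - 1)\<^sup>2) * exp (- s))"
    "smooth UNIV \<gamma>"
proof -
  obtain f g a where fg: "null_pair f g" "a \<noteq> 0"
    and f: "\<And>p. f (L p) = a * null_plus p" and g: "\<And>p. g (L p) = null_minus p / a"
    using linear_isometry_null_pair[OF assms(1)] by metis
  have L: "bounded_linear L"
    using assms(1) by (simp add: linear_isometry_def linear_conv_bounded_linear)
  then have rL: "bounded_linear (\<lambda>p. r *\<^sub>R L p)"
    by (rule bounded_linear_compose[OF bounded_linear_scaleR_right])
  have lin: "f (r *\<^sub>R p) = r * f p" "g (r *\<^sub>R p) = r * g p" for p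
    using null_pair_linear[OF fg(1)] null_pair_linear[OF null_pair_sym[OF fg(1)]]
    by (simp_all add: linear_scale bounded_linear.linear)
  have d1: "(\<gamma> has_vector_derivative r *\<^sub>R L (model_velocity \<alpha> c s)) (at s)" for s
    unfolding \<gamma>_def by (rule bounded_linear.has_vector_derivative[OF rL model_curve_derivative])
  have d2: "((\<lambda>s. r *\<^sub>R L (model_velocity \<alpha> c s)) has_vector_derivative
      r *\<^sub>R L (model_acceleration \<alpha> c s)) (at s)" for s
    by (rule bounded_linear.has_vector_derivative[OF rL model_velocity_derivative])
  have n: "nth_vderiv 1 \<gamma> s = r *\<^sub>R L (model_velocity \<alpha> c s)"
    "nth_vderiv 2 \<gamma> s = r *\<^sub>R L (model_acceleration \<alpha> c s)" for s
    using nth_vderiv_1_eq[OF d1] nth_vderiv_2_eq[OF open_UNIV UNIV_I d1 d2] by auto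
  show thesis
  proof (rule that[OF fg])
    show "smooth UNIV \<gamma>"
      unfolding \<gamma>_def by (rule smooth_bounded_linear[OF rL smooth_model_curve])
    show "f (\<gamma> s) = r * a * (rho \<alpha> c s * exp s)"
      "g (\<gamma> s) = r / a * (rho \<alpha> c s * exp (- s))" for s
      by (simp_all add: \<gamma>_def lin f g null_plus_model null_minus_model)
  qed (simp_all only: n lin f g null_plus_model_velocity null_minus_model_velocity
      null_plus_model_acceleration null_minus_model_acceleration, simp_all)
qed

lemma model_image_timelike_solution:
  assumes "linear_isometry L" "r > 0" "admissible \<alpha> c"
  shows "timelike_solution \<alpha> UNIV (\<lambda>s. r *\<^sub>R L (model_curve \<alpha> c s))"
    (is "timelike_solution \<alpha> UNIV ?\<gamma>")
proof -
  obtain f g a where fg: "null_pair f g" "a \<noteq> 0"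
    and n: "\<And>s. f (?\<gamma> s) = r * a * (rho \<alpha> c s * exp s)"
    "\<And>s. g (?\<gamma> s) = r / a * (rho \<alpha> c s * exp (- s))"
    "\<And>s. f (nth_vderiv 1 ?\<gamma> s) = r * a * (rho \<alpha> c s * (log_slope \<alpha> c s + 1) * exp s)"
    "\<And>s. g (nth_vderiv 1 ?\<gamma> s) = r / a * (rho \<alpha> c s * (log_slope \<alpha> c s - 1) * exp (- s))"
    "\<And>s. f (nth_vderiv 2 ?\<gamma> s) = r * a * (rho \<alpha> c s *
        ((\<alpha> - 1) * (1 - (log_slope \<alpha> c s)\<^sup>2) + (log_slope \<alpha> c s + 1)\<^sup>2) * exp s)"
    "\<And>s. g (nth_vderiv 2 ?\<gamma> s) = r / a * (rho \<alpha> c s *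
        ((\<alpha> - 1) * (1 - (log_slope \<alpha> c s)\<^sup>2) + (log_slope \<alpha> c s - 1)\<^sup>2) * exp (- s))"
    and sm: "smooth UNIV ?\<gamma>"
    by (rule model_image_null_coordinates[OF assms(1,2), of \<alpha> c]) (rule that; assumption)
  have e: "exp s * exp (- s) = 1" for s :: real by (simp flip: exp_add)
  have "lprod (?\<gamma> s) (?\<gamma> s) > 0" for s
  proof -
    have "lprod (?\<gamma> s) (?\<gamma> s) = (r * rho \<alpha> c s)\<^sup>2 * (exp s * exp (- s))"
      unfolding lprod_self_null_pair[OF fg(1)] n using fg(2) by (simp add: power2_eq_square)
    then show ?thesis using assms(2) rho_pos[of \<alpha> c s] unfolding e by simp
  qed
  moreover have "lprod (nth_vderiv 1 ?\<gamma> s) (nth_vderiv 1 ?\<gamma> s) < 0" for s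
  proof -
    have "lprod (nth_vderiv 1 ?\<gamma> s) (nth_vderiv 1 ?\<gamma> s) =
        (r * rho \<alpha> c s)\<^sup>2 * ((log_slope \<alpha> c s + 1) * (log_slope \<alpha> c s - 1)) * (exp s * exp (- s))"
      unfolding lprod_self_null_pair[OF fg(1)] n using fg(2) by (simp add: power2_eq_square)
    moreover have "(log_slope \<alpha> c s + 1) * (log_slope \<alpha> c s - 1) < 0"
      using abs_log_slope_less_1[OF assms(3), of s] by (simp add: mult_less_0_iff abs_less_iff)
    moreover have "(r * rho \<alpha> c s)\<^sup>2 > 0" using assms(2) rho_pos[of \<alpha> c s] by simp
    ultimately show ?thesis unfolding e by (simp add: mult_less_0_iff)
  qed
  moreover have "stationary_eq \<alpha> (?\<gamma> s) (nth_vderiv 1 ?\<gamma> s) (nth_vderiv 2 ?\<gamma> s)" for s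
  proof -
    define w where "w = log_slope \<alpha> c s"
    define x where "x = r * a * (rho \<alpha> c s * exp s)"
    define y where "y = r / a * (rho \<alpha> c s * exp (- s))"
    have e: "f (?\<gamma> s) = x" "g (?\<gamma> s) = y"
      "f (nth_vderiv 1 ?\<gamma> s) = x * (w + 1)" "g (nth_vderiv 1 ?\<gamma> s) = y * (w - 1)"
      "f (nth_vderiv 2 ?\<gamma> s) = x * ((\<alpha> - 1) * (1 - w\<^sup>2) + (w + 1)\<^sup>2)"
      "g (nth_vderiv 2 ?\<gamma> s) = y * ((\<alpha> - 1) * (1 - w\<^sup>2) + (w - 1)\<^sup>2)"
      unfolding n w_def x_def y_def by simp_all
    show ?thesis
      unfolding stationary_eq_null_pair[OF fg(1)] e by algebra
  qed
  ultimately show ?thesis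
    using sm by (simp add: timelike_solution_def open_interval_def)
qed

section \<open>Limits of curves in null coordinates\<close>

text \<open>The line through \<open>v\<close> on which \<open>g\<close> is constant contains a point with the same value of \<open>f\<close> as
  \<open>\<gamma> s\<close>; its distance to \<open>\<gamma> s\<close> is at most \<open>\<bar>g (\<gamma> s) - g v\<bar>\<close>.\<close>

lemma asymptotic_to_cone_null_coordinates:
  assumes "null_pair f g" "filterlim (\<lambda>s. \<bar>f (\<gamma> s)\<bar>) at_top F" "((\<lambda>s. g (\<gamma> s)) \<longlongrightarrow> g v) F"
  shows "asymptotic_to_cone_at \<gamma> F v"
proof -
  have lin: "f (x - y) = f x - f y" "g (x - y) = g x - g y"
    "f (x + y) = f x + f y" "g (x + y) = g x + g y" for x y
    using null_pair_linear[OF assms(1)] null_pair_linear[OF null_pair_sym[OF assms(1)]]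
    by (simp_all add: linear_diff linear_add bounded_linear.linear)
  have le: "\<bar>f x\<bar> \<le> 2 * norm x" for x
  proof (rule power2_le_imp_le)
    have "(f x)\<^sup>2 \<le> (2 * norm x)\<^sup>2"
      unfolding power_mult_distrib norm_null_pair[OF assms(1)] by (auto intro: add_increasing2)
    then show "\<bar>f x\<bar>\<^sup>2 \<le> (2 * norm x)\<^sup>2" by simp
  qed simp
  have "filterlim (\<lambda>s. 2 * norm (\<gamma> s)) at_top F"
    by (rule filterlim_at_top_mono[OF assms(2)]) (simp add: le)
  then have "filterlim (\<lambda>s. (1/2) * (2 * norm (\<gamma> s))) at_top F"
    by (rule filterlim_tendsto_pos_mult_at_top[OF tendsto_const, rotated]) simp
  then have inf: "filterlim \<gamma> at_infinity F"
    by (simp add: filterlim_at_infinity_conv_norm_at_top)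
  define l where "l = {p. g p = 0}"
  have "l \<in> cone_lines"
    using assms(1) by (rule null_pair_cases)
      (auto simp: l_def cone_lines_def null_plus_def null_minus_def set_eq_iff)
  moreover have "((\<lambda>s. infdist (\<gamma> s) ((+) v ` l)) \<longlongrightarrow> 0) F"
  proof (rule tendsto_sandwich[OF always_eventually always_eventually tendsto_const])
    show "((\<lambda>s. \<bar>g (\<gamma> s) - g v\<bar>) \<longlongrightarrow> 0) F"
      using assms(3) by (simp add: LIM_zero tendsto_rabs_zero)
    show "\<forall>s. infdist (\<gamma> s) ((+) v ` l) \<le> \<bar>g (\<gamma> s) - g v\<bar>"
    proof
      fix s
      obtain z where z: "f z = f (\<gamma> s) - f v" "g z = 0"
        using null_pair_ex[OF assms(1)] .
      have "(dist (\<gamma> s) (v + z))\<^sup>2 = (g (\<gamma> s) - g v)\<^sup>2 / 2"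
        unfolding dist_norm norm_null_pair[OF assms(1)] by (simp add: lin z)
      also have "\<dots> \<le> \<bar>g (\<gamma> s) - g v\<bar>\<^sup>2"
        using zero_le_power2[of "g (\<gamma> s) - g v"] unfolding power2_abs by linarith
      finally have "dist (\<gamma> s) (v + z) \<le> \<bar>g (\<gamma> s) - g v\<bar>"
        by (rule power2_le_imp_le) simp
      moreover have "v + z \<in> (+) v ` l" using z by (simp add: l_def)
      ultimately show "infdist (\<gamma> s) ((+) v ` l) \<le> \<bar>g (\<gamma> s) - g v\<bar>"
        by (rule infdist_le2[rotated])
    qed
  qed (simp add: infdist_nonneg)
  ultimately show ?thesis
    using inf by (auto simp: asymptotic_to_cone_at_def)
qed

lemma null_pair_basis:
  assumes "null_pair f g"
  obtains e e' where "f e = 1" "g e = 0" "\<And>p. p = f p *\<^sub>R e + g p *\<^sub>R e'"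
proof -
  obtain e where e: "f e = 1" "g e = 0" using null_pair_ex[OF assms] .
  obtain e' where e': "f e' = 0" "g e' = 1" using null_pair_ex[OF assms] .
  have "linear f" "linear g"
    using null_pair_linear assms null_pair_sym bounded_linear.linear by blast+
  then have "p = f p *\<^sub>R e + g p *\<^sub>R e'" for p
    by (intro null_pair_eqI[OF assms]) (simp_all add: linear_add linear_scale e e')
  with e show thesis by (rule that)
qed

lemma tendsto_null_coordinates:
  assumes "null_pair f g" "((\<lambda>s. f (\<gamma> s)) \<longlongrightarrow> f p) F" "((\<lambda>s. g (\<gamma> s)) \<longlongrightarrow> g p) F"
  shows "(\<gamma> \<longlongrightarrow> p) F"
proof -
  obtain e e' where e: "\<And>p. p = f p *\<^sub>R e + g p *\<^sub>R e'"
    using null_pair_basis[OF assms(1)] by metis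
  have "((\<lambda>s. f (\<gamma> s) *\<^sub>R e + g (\<gamma> s) *\<^sub>R e') \<longlongrightarrow> f p *\<^sub>R e + g p *\<^sub>R e') F"
    by (intro tendsto_intros assms)
  then show ?thesis by (simp flip: e)
qed

text \<open>Dividing \<open>v s\<close> by \<open>f (v s)\<close> gives a vector converging to the basis vector of the line \<open>g = 0\<close>. The
  constant sign of \<open>f (v s)\<close> makes the normalized vectors converge and not only the lines they span.\<close>

lemma direction_tendsto_null_line:
  fixes v :: "real \<Rightarrow> real \<times> real"
  assumes "null_pair f g" "\<And>s. sgn (f (v s)) = \<sigma>" "\<sigma> \<noteq> 0" "((\<lambda>s. g (v s) / f (v s)) \<longlongrightarrow> 0) F"
  shows "\<exists>u. norm u = 1 \<and> ((\<lambda>s. sgn (v s)) \<longlongrightarrow> u) F \<and> g u = 0"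
proof -
  obtain e e' where e: "f e = 1" "g e = 0" "\<And>p. p = f p *\<^sub>R e + g p *\<^sub>R e'"
    using null_pair_basis[OF assms(1)] by metis
  have lin: "linear f" "linear g"
    using null_pair_linear assms null_pair_sym bounded_linear.linear by blast+
  have "e \<noteq> 0" using e(1) linear_0[OF lin(1)] by auto
  have nz: "f (v s) \<noteq> 0" for s using assms(2)[of s] assms(3) by auto
  have "v s = f (v s) *\<^sub>R (e + (g (v s) / f (v s)) *\<^sub>R e')" for s
    by (subst e(3)[of "v s"]) (simp add: scaleR_add_right nz)
  then have "sgn (v s) = \<sigma> *\<^sub>R sgn (e + (g (v s) / f (v s)) *\<^sub>R e')" for s
    using assms(2)[of s] sgn_scaleR by metis
  moreover have "((\<lambda>s. e + (g (v s) / f (v s)) *\<^sub>R e') \<longlongrightarrow> e + 0 *\<^sub>R e') F"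
    by (intro tendsto_intros assms(4))
  then have "((\<lambda>s. \<sigma> *\<^sub>R sgn (e + (g (v s) / f (v s)) *\<^sub>R e')) \<longlongrightarrow> \<sigma> *\<^sub>R sgn e) F"
    using \<open>e \<noteq> 0\<close> by (intro tendsto_intros) simp_all
  moreover have "\<bar>\<sigma>\<bar> = 1" using assms(2)[of 0] assms(3) by (auto simp: sgn_if split: if_splits)
  then have "norm (\<sigma> *\<^sub>R sgn e) = 1" using \<open>e \<noteq> 0\<close> by (simp add: norm_sgn)
  moreover have "g (\<sigma> *\<^sub>R sgn e) = 0"
    by (simp add: sgn_div_norm linear_scale[OF lin(2)] e(2))
  ultimately show ?thesis
    by (intro exI[of _ "\<sigma> *\<^sub>R sgn e"]) simp
qed

lemma meets_cone_tangentially_null_coordinates: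
  assumes "null_pair f g" "((\<lambda>s. f (\<gamma> s)) \<longlongrightarrow> f p) F" "((\<lambda>s. g (\<gamma> s)) \<longlongrightarrow> 0) F"
    "f p \<noteq> 0" "g p = 0"
    "\<And>s. sgn (f (nth_vderiv 1 \<gamma> s)) = \<sigma>" "\<sigma> \<noteq> 0"
    "((\<lambda>s. g (nth_vderiv 1 \<gamma> s) / f (nth_vderiv 1 \<gamma> s)) \<longlongrightarrow> 0) F"
  shows "meets_cone_tangentially \<gamma> F p"
proof -
  have lin: "linear f" "linear g"
    using null_pair_linear assms(1) null_pair_sym bounded_linear.linear by blast+
  obtain u where u: "norm u = 1" "((\<lambda>s. sgn (nth_vderiv 1 \<gamma> s)) \<longlongrightarrow> u) F" "g u = 0"
    using direction_tendsto_null_line[OF assms(1,6,7,8)] by auto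
  have "u = (f u / f p) *\<^sub>R p"
    by (rule null_pair_eqI[OF assms(1)])
       (simp_all add: linear_scale[OF lin(1)] linear_scale[OF lin(2)] assms(4,5) u(3))
  then have "u \<in> span {p}" by (metis span_scale span_base singletonI)
  moreover have "p \<noteq> 0" using assms(4) linear_0[OF lin(1)] by auto
  moreover have "p \<in> light_cone" by (simp add: light_cone_def lprod_self_null_pair[OF assms(1)] assms(5))
  ultimately show ?thesis
    using u tendsto_null_coordinates[OF assms(1,2)] assms(3,5)
    unfolding meets_cone_tangentially_def by (metis (no_types))
qed

lemma meets_cone_orthogonally_null_coordinates:
  assumes "null_pair f g" "((\<lambda>s. f (\<gamma> s)) \<longlongrightarrow> f p) F" "((\<lambda>s. g (\<gamma> s)) \<longlongrightarrow> 0) F"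
    "f p \<noteq> 0" "g p = 0"
    "\<And>s. sgn (g (nth_vderiv 1 \<gamma> s)) = \<sigma>" "\<sigma> \<noteq> 0"
    "((\<lambda>s. f (nth_vderiv 1 \<gamma> s) / g (nth_vderiv 1 \<gamma> s)) \<longlongrightarrow> 0) F"
  shows "meets_cone_orthogonally \<gamma> F p"
proof -
  have lin: "linear f" using null_pair_linear assms(1) bounded_linear.linear by blast
  obtain u where u: "norm u = 1" "((\<lambda>s. sgn (nth_vderiv 1 \<gamma> s)) \<longlongrightarrow> u) F" "f u = 0"
    using direction_tendsto_null_line[OF null_pair_sym[OF assms(1)] assms(6,7,8)] by auto
  have "inner u p = 0"
    using assms(1)
    by (rule null_pair_cases)
       (use u(3) assms(5) in \<open>auto simp: inner_prod_def null_plus_def null_minus_def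
          add_eq_0_iff2\<close>)
  moreover have "p \<noteq> 0" using assms(4) linear_0[OF lin] by auto
  moreover have "p \<in> light_cone" by (simp add: light_cone_def lprod_self_null_pair[OF assms(1)] assms(5))
  ultimately show ?thesis
    using u tendsto_null_coordinates[OF assms(1,2)] assms(3,5)
    unfolding meets_cone_orthogonally_def by (metis (no_types))
qed

section \<open>Branches of the model curves\<close>

lemma exp_mult_tendsto_0:
  fixes k :: real
  shows "k < 0 \<Longrightarrow> ((\<lambda>s. exp (k * s)) \<longlongrightarrow> 0) at_top"
    and "k > 0 \<Longrightarrow> ((\<lambda>s. exp (k * s)) \<longlongrightarrow> 0) at_bot"
proof -
  have top: "((\<lambda>s. exp (k * s)) \<longlongrightarrow> 0) at_top" if "k < 0" for k :: real
    by (rule filterlim_compose[OF exp_at_bot],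
        rule filterlim_tendsto_neg_mult_at_bot[OF tendsto_const that filterlim_ident])
  show "k < 0 \<Longrightarrow> ((\<lambda>s. exp (k * s)) \<longlongrightarrow> 0) at_top" by (rule top)
  show "k > 0 \<Longrightarrow> ((\<lambda>s. exp (k * s)) \<longlongrightarrow> 0) at_bot"
    using top[of "- k"] by (simp add: filterlim_at_bot_mirror)
qed

lemma rho_minus: "\<alpha> \<noteq> 1 \<Longrightarrow> rho \<alpha> c (- s) = rho \<alpha> c s"
  by (simp add: rho_def)

text \<open>Since \<open>cosh y = exp y * ((1 + exp (- 2 * y)) / 2)\<close>, the factor \<open>exp s\<close> in the growth of \<open>rho\<close> splits
  off exactly, leaving a quantity whose limit can be read off.\<close>

lemma rho_times_exp:
  assumes "\<alpha> \<noteq> 1"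
  shows "rho \<alpha> c s * exp (- s) = exp (ln ((1 + exp (- 2 * (\<alpha> - 1) * s)) / 2) / (\<alpha> - 1))"
    and "rho \<alpha> c s * exp s = exp (ln ((1 + exp (2 * (\<alpha> - 1) * s)) / 2) / (\<alpha> - 1))"
proof -
  have *: "rho \<alpha> c s * exp (- s) = exp (ln ((1 + exp (- 2 * (\<alpha> - 1) * s)) / 2) / (\<alpha> - 1))" for s
  proof -
    define m where "m = \<alpha> - 1"
    have "m \<noteq> 0" using assms by (simp add: m_def)
    have "cosh (m * s) = exp (m * s) * ((1 + exp (- 2 * m * s)) / 2)"
      by (simp add: cosh_def field_simps flip: exp_add)
    moreover have "(1 + exp (- 2 * m * s)) / 2 > 0" by (simp add: add_pos_pos)
    ultimately have "ln (cosh (m * s)) = m * s + ln ((1 + exp (- 2 * m * s)) / 2)"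
      by (simp only: ln_mult_pos exp_gt_zero ln_exp)
    then have "ln (cosh (m * s)) / m - s = ln ((1 + exp (- 2 * m * s)) / 2) / m"
      using \<open>m \<noteq> 0\<close> by (simp add: field_simps)
    then show ?thesis
      using assms by (simp add: rho_exp m_def flip: exp_add)
  qed
  show "rho \<alpha> c s * exp (- s) = exp (ln ((1 + exp (- 2 * (\<alpha> - 1) * s)) / 2) / (\<alpha> - 1))" by (rule *)
  show "rho \<alpha> c s * exp s = exp (ln ((1 + exp (2 * (\<alpha> - 1) * s)) / 2) / (\<alpha> - 1))"
  proof -
    have e: "- 2 * (\<alpha> - 1) * - s = 2 * (\<alpha> - 1) * s"
      by (simp add: algebra_simps)
    show ?thesis using *[of "- s"] unfolding e minus_minus rho_minus[OF assms] .
  qed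
qed

text \<open>The common limit of \<open>rho * exp (- s)\<close> and \<open>rho * exp s\<close> at those ends where they converge to a
  nonzero number, for \<open>\<alpha> \<noteq> 1\<close>.\<close>

definition rho_limit :: "real \<Rightarrow> real" where
  "rho_limit \<alpha> = exp (ln (1 / 2) / (\<alpha> - 1))"

lemma rho_limits:
  shows "\<alpha> > 1 \<Longrightarrow> ((\<lambda>s. rho \<alpha> c s * exp (- s)) \<longlongrightarrow> rho_limit \<alpha>) at_top"
    and "\<alpha> < 1 \<Longrightarrow> ((\<lambda>s. rho \<alpha> c s * exp s) \<longlongrightarrow> rho_limit \<alpha>) at_top"
    and "\<alpha> > 1 \<Longrightarrow> ((\<lambda>s. rho \<alpha> c s * exp s) \<longlongrightarrow> rho_limit \<alpha>) at_bot"
    and "\<alpha> < 1 \<Longrightarrow> ((\<lambda>s. rho \<alpha> c s * exp (- s)) \<longlongrightarrow> rho_limit \<alpha>) at_bot"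
proof -
  have *: "((\<lambda>s. exp (ln ((1 + exp (k * s)) / 2) / (\<alpha> - 1))) \<longlongrightarrow> rho_limit \<alpha>) F"
    if "\<alpha> \<noteq> 1" "((\<lambda>s. exp (k * s)) \<longlongrightarrow> 0) F" for k F
  proof -
    have "((\<lambda>s. exp (ln ((1 + exp (k * s)) / 2) / (\<alpha> - 1))) \<longlongrightarrow>
        exp (ln ((1 + 0) / 2) / (\<alpha> - 1))) F"
      by (intro tendsto_intros that) (use that(1) in auto)
    then show ?thesis by (simp add: rho_limit_def)
  qed
  show "\<alpha> > 1 \<Longrightarrow> ((\<lambda>s. rho \<alpha> c s * exp (- s)) \<longlongrightarrow> rho_limit \<alpha>) at_top"
    "\<alpha> < 1 \<Longrightarrow> ((\<lambda>s. rho \<alpha> c s * exp s) \<longlongrightarrow> rho_limit \<alpha>) at_top"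
    "\<alpha> > 1 \<Longrightarrow> ((\<lambda>s. rho \<alpha> c s * exp s) \<longlongrightarrow> rho_limit \<alpha>) at_bot"
    "\<alpha> < 1 \<Longrightarrow> ((\<lambda>s. rho \<alpha> c s * exp (- s)) \<longlongrightarrow> rho_limit \<alpha>) at_bot"
    by (simp only: rho_times_exp less_imp_neq less_imp_neq[symmetric] not_False_eq_True,
        intro * exp_mult_tendsto_0, auto)+
qed

text \<open>The identity \<open>tanh y - 1 = - exp (- 2 * y) * (tanh y + 1)\<close>. It yields the ratio of the null coordinates
  of the velocity.\<close>

lemma log_slope_minus_1:
  assumes "\<alpha> \<noteq> 1"
  shows "log_slope \<alpha> c s - 1 = - exp (- 2 * (\<alpha> - 1) * s) * (log_slope \<alpha> c s + 1)"
proof -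
  have "1 + exp (- 2 * ((\<alpha> - 1) * s)) \<noteq> 0"
    by (smt (verit) exp_gt_zero)
  then show ?thesis
    using assms by (simp add: log_slope_def tanh_real_altdef field_simps)
qed

lemma filterlim_exp_times_at_top:
  fixes f :: "real \<Rightarrow> real"
  assumes "k > 0" "\<And>s. k * exp (l * s) \<le> f s"
  shows "l > 0 \<Longrightarrow> filterlim f at_top at_top" and "l < 0 \<Longrightarrow> filterlim f at_top at_bot"
proof -
  have e: "filterlim (\<lambda>s. k * exp (l * s)) at_top F" if "filterlim (\<lambda>s. l * s) at_top F" for F
    by (rule filterlim_tendsto_pos_mult_at_top[OF tendsto_const assms(1)
          filterlim_compose[OF exp_at_top that]])
  show "filterlim f at_top at_top" if "l > 0"
    by (rule filterlim_at_top_mono[OF e always_eventually])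
       (use assms(2) filterlim_tendsto_pos_mult_at_top[OF tendsto_const that filterlim_ident] in auto)
  show "filterlim f at_top at_bot" if "l < 0"
  proof (rule filterlim_at_top_mono[OF e always_eventually])
    have "filterlim (\<lambda>s. (- l) * s) at_top at_top"
      using that by (intro filterlim_tendsto_pos_mult_at_top[OF tendsto_const _ filterlim_ident]) simp
    then show "filterlim (\<lambda>s. l * s) at_top at_bot"
      by (simp add: filterlim_at_bot_mirror)
  qed (use assms(2) in auto)
qed

text \<open>At each end one null coordinate diverges and the other one tends to a nonzero constant. A vertical
  vector can match either constant but in general not both, whence \<open>a\<close> and \<open>b\<close>; some vector \<open>v\<close>
  matches both.\<close>

lemma model_image_asymptotic_to_translated_cone:
  fixes \<alpha> c :: real
  assumes "linear_isometry L" "r > 0" "\<alpha> > 1"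
  defines "\<gamma> \<equiv> \<lambda>s. r *\<^sub>R L (model_curve \<alpha> c s)"
  shows "(\<exists>a b. a \<noteq> 0 \<and> b \<noteq> 0 \<and> asymptotic_to_cone_at \<gamma> at_top (0, a) \<and>
              asymptotic_to_cone_at \<gamma> at_bot (0, b)) \<and>
         (\<exists>v. v \<noteq> 0 \<and> asymptotic_to_cone_at \<gamma> at_top v \<and> asymptotic_to_cone_at \<gamma> at_bot v)"
proof -
  obtain f g a where fg: "null_pair f g" "a \<noteq> 0"
    and f: "\<And>s. f (\<gamma> s) = r * a * (rho \<alpha> c s * exp s)"
    and g: "\<And>s. g (\<gamma> s) = r / a * (rho \<alpha> c s * exp (- s))"
    unfolding \<gamma>_def
    by (rule model_image_null_coordinates[OF assms(1,2), of \<alpha> c])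
      (rule that[unfolded \<gamma>_def]; assumption)
  define k where "k = rho_limit \<alpha>"
  have "k \<noteq> 0" by (simp add: k_def rho_limit_def)
  have "rho \<alpha> c s \<ge> 1" for s
    using assms(3) by (auto simp: rho_exp cosh_real_ge_1)
  then have "r * \<bar>a\<bar> * exp (1 * s) \<le> \<bar>f (\<gamma> s)\<bar>" "r / \<bar>a\<bar> * exp ((-1) * s) \<le> \<bar>g (\<gamma> s)\<bar>" for s
    using assms(2) fg(2) rho_pos[of \<alpha> c s]
    by (auto simp: f g abs_mult divide_right_mono)
  note large = filterlim_exp_times_at_top[OF _ this(1)] filterlim_exp_times_at_top[OF _ this(2)]
  have f_top: "filterlim (\<lambda>s. \<bar>f (\<gamma> s)\<bar>) at_top at_top" using large(1) assms(2) fg(2) by simp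
  have g_bot: "filterlim (\<lambda>s. \<bar>g (\<gamma> s)\<bar>) at_top at_bot" using large(4) assms(2) fg(2) by simp
  have g_top: "((\<lambda>s. g (\<gamma> s)) \<longlongrightarrow> r / a * k) at_top"
    and f_bot: "((\<lambda>s. f (\<gamma> s)) \<longlongrightarrow> r * a * k) at_bot"
    unfolding f g k_def by (intro tendsto_mult_left rho_limits assms(3))+
  have top: "asymptotic_to_cone_at \<gamma> at_top v" if "g v = r / a * k" for v
    using asymptotic_to_cone_null_coordinates[OF fg(1) f_top] g_top that by simp
  have bot: "asymptotic_to_cone_at \<gamma> at_bot v" if "f v = r * a * k" for v
    using asymptotic_to_cone_null_coordinates[OF null_pair_sym[OF fg(1)] g_bot] f_bot that by simp
  obtain e where "\<bar>e\<bar> = 1" and e: "\<And>y. f (0, y) = e * y" "\<And>y. g (0, y) = - e * y"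
    using null_pair_vertical[OF fg(1)] by metis
  then have "e * e = 1" by (auto simp: abs_if split: if_splits)
  then have "g (0, - e * (r / a * k)) = r / a * k" "f (0, e * (r * a * k)) = r * a * k"
    unfolding e by (simp_all flip: mult.assoc)
  moreover have "- e * (r / a * k) \<noteq> 0" "e * (r * a * k) \<noteq> 0"
    using \<open>\<bar>e\<bar> = 1\<close> \<open>k \<noteq> 0\<close> assms(2) fg(2) by auto
  moreover obtain v where v: "f v = r * a * k" "g v = r / a * k"
    using null_pair_ex[OF fg(1)] .
  moreover have "v \<noteq> 0"
  proof
    assume "v = 0"
    then have "f v = 0" using e(1)[of 0] by (simp add: zero_prod_def)
    then show False using v \<open>k \<noteq> 0\<close> assms(2) fg(2) by simp
  qed
  ultimately show ?thesis
    using top bot by metis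
qed

lemma model_image_asymptotic_to_cone:
  fixes c :: real
  assumes "linear_isometry L" "r > 0" "\<bar>c\<bar> < 1"
  defines "\<gamma> \<equiv> \<lambda>s. r *\<^sub>R L (model_curve 1 c s)"
  shows "asymptotic_to_cone_at \<gamma> at_top 0" "asymptotic_to_cone_at \<gamma> at_bot 0"
proof -
  obtain f g a where fg: "null_pair f g" "a \<noteq> 0"
    and f: "\<And>s. f (\<gamma> s) = r * a * (rho 1 c s * exp s)"
    and g: "\<And>s. g (\<gamma> s) = r / a * (rho 1 c s * exp (- s))"
    unfolding \<gamma>_def
    by (rule model_image_null_coordinates[OF assms(1,2), of 1 c])
      (rule that[unfolded \<gamma>_def]; assumption)
  have f: "f (\<gamma> s) = r * a * exp ((c + 1) * s)" and g: "g (\<gamma> s) = r / a * exp ((c - 1) * s)" for s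
    unfolding f g by (simp_all add: rho_def distrib_right left_diff_distrib exp_diff exp_minus divide_inverse flip: exp_add)
  have c: "c + 1 > 0" "c - 1 < 0" using assms(3) by (simp_all add: abs_less_iff)
  have "r * \<bar>a\<bar> * exp ((c + 1) * s) \<le> \<bar>f (\<gamma> s)\<bar>" "r / \<bar>a\<bar> * exp ((c - 1) * s) \<le> \<bar>g (\<gamma> s)\<bar>" for s
    using assms(2) by (simp_all add: f g abs_mult)
  note large = filterlim_exp_times_at_top[OF _ this(1)] filterlim_exp_times_at_top[OF _ this(2)]
  have f_top: "filterlim (\<lambda>s. \<bar>f (\<gamma> s)\<bar>) at_top at_top" using large(1) assms(2) fg(2) c by simp
  have g_bot: "filterlim (\<lambda>s. \<bar>g (\<gamma> s)\<bar>) at_top at_bot" using large(4) assms(2) fg(2) c by simp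
  have "((\<lambda>s. g (\<gamma> s)) \<longlongrightarrow> r / a * 0) at_top" "((\<lambda>s. f (\<gamma> s)) \<longlongrightarrow> r * a * 0) at_bot"
    unfolding f g by (intro tendsto_mult_left exp_mult_tendsto_0 c)+
  moreover have "f 0 = 0" "g 0 = 0"
    using null_pair_linear[OF fg(1)] null_pair_linear[OF null_pair_sym[OF fg(1)]]
    by (simp_all add: linear_0 bounded_linear.linear)
  ultimately show "asymptotic_to_cone_at \<gamma> at_top 0" "asymptotic_to_cone_at \<gamma> at_bot 0"
    using asymptotic_to_cone_null_coordinates[OF fg(1) f_top, of 0]
      asymptotic_to_cone_null_coordinates[OF null_pair_sym[OF fg(1)] g_bot, of 0] by simp_all
qed

text \<open>On \<open>lprod p p = r\<^sup>2\<close> the null coordinate \<open>f\<close> never vanishes, so a connected set containing the curve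
  stays on the branch where \<open>f\<close> has the sign of \<open>a\<close>; the curve covers this branch.\<close>

lemma pseudocircle_range_model_image:
  assumes "linear_isometry L" "r > 0"
  defines "\<gamma> \<equiv> \<lambda>s. r *\<^sub>R L (model_curve 1 0 s)"
  shows "pseudocircle r (range \<gamma>)"
proof -
  obtain f g a where fg: "null_pair f g" "a \<noteq> 0"
    and f: "\<And>s. f (\<gamma> s) = r * a * (rho 1 0 s * exp s)"
    and g: "\<And>s. g (\<gamma> s) = r / a * (rho 1 0 s * exp (- s))"
    and smooth: "smooth UNIV \<gamma>"
    unfolding \<gamma>_def
    by (rule model_image_null_coordinates[OF assms(1,2), of 1 0])
      (rule that[unfolded \<gamma>_def]; assumption)
  have [simp]: "rho 1 0 s = 1" for s by (simp add: rho_def)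
  let ?S = "{p. lprod p p = r\<^sup>2}"
  have branch: "p \<in> range \<gamma>" if "p \<in> ?S" "a * f p > 0" for p
  proof -
    define s where "s = ln (f p / (r * a))"
    have "f p / (r * a) > 0"
      using that(2) assms(2) fg(2) by (auto simp: zero_less_divide_iff zero_less_mult_iff mult_less_0_iff)
    then have s: "exp s = f p / (r * a)" by (simp add: s_def)
    have "f p * g p = r\<^sup>2" using that(1) by (simp add: lprod_self_null_pair[OF fg(1)])
    moreover have "f p \<noteq> 0" using that(2) by auto
    ultimately have "g p = r\<^sup>2 / f p" by (simp add: field_simps)
    then have "p = \<gamma> s"
      using assms(2) fg(2) \<open>f p \<noteq> 0\<close>
      by (intro null_pair_eqI[OF fg(1)])
         (simp_all add: f g exp_minus s power2_eq_square field_simps)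
    then show ?thesis by blast
  qed
  have sub: "range \<gamma> \<subseteq> ?S"
  proof (rule image_subsetI)
    fix s :: real
    have "exp s * exp (- s) = 1" by (simp flip: exp_add)
    then show "\<gamma> s \<in> ?S"
      using fg(2) by (simp add: lprod_self_null_pair[OF fg(1)] f g power2_eq_square field_simps)
  qed
  have "continuous_on UNIV \<gamma>" by (rule smooth_imp_continuous_on[OF smooth open_UNIV])
  then have conn: "connected (range \<gamma>)" by (rule connected_continuous_image[OF _ connected_UNIV])
  have "T \<subseteq> range \<gamma>" if T: "connected T" "T \<subseteq> ?S" "range \<gamma> \<subseteq> T" for T
  proof
    fix p assume "p \<in> T"
    have lin: "bounded_linear f" by (rule null_pair_linear[OF fg(1)])
    have "continuous_on T f" by (rule linear_continuous_on[OF lin])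
    then have "continuous_on T (\<lambda>p. a * f p)" by (intro continuous_intros)
    then have "is_interval ((\<lambda>p. a * f p) ` T)"
      using connected_continuous_image T(1) is_interval_connected_1 by blast
    moreover have "a * f (\<gamma> 0) \<in> (\<lambda>p. a * f p) ` T" using T(3) by auto
    moreover have "a * f p \<in> (\<lambda>p. a * f p) ` T" using \<open>p \<in> T\<close> by auto
    moreover have "a * f (\<gamma> 0) > 0" using assms(2) fg(2) by (auto simp: f zero_less_mult_iff mult_less_0_iff)
    moreover have "0 \<notin> (\<lambda>p. a * f p) ` T"
      using T(2) fg(2) assms(2) by (auto simp: lprod_self_null_pair[OF fg(1)])
    ultimately have "a * f p > 0"
      by (smt (verit) mem_is_interval_1_I)
    then show "p \<in> range \<gamma>" using branch \<open>p \<in> T\<close> T(2) by blast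
  qed
  then have "range \<gamma> \<in> components ?S"
    unfolding in_components_maximal using sub conn by blast
  then show ?thesis using assms(2) by (simp add: pseudocircle_def)
qed

text \<open>At \<open>s \<rightarrow> \<infinity>\<close> the limit point lies on \<open>g = 0\<close>, and there \<open>g'/f'\<close> is a constant times
  \<open>exp (- 2 * \<alpha> * s)\<close>. For \<open>\<alpha> > 0\<close> the \<open>f\<close>-component of the velocity dominates, which is the direction of
  the line; for \<open>\<alpha> < 0\<close> the \<open>g\<close>-component does, and the two null lines are perpendicular. At the
  other end \<open>f\<close> and \<open>g\<close> exchange their roles.\<close>

lemma model_image_meets_cone:
  fixes \<alpha> c :: real
  assumes "linear_isometry L" "r > 0" "\<alpha> < 1"
  defines "\<gamma> \<equiv> \<lambda>s. r *\<^sub>R L (model_curve \<alpha> c s)"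
  shows "\<exists>p q. p \<noteq> q \<and>
     (\<alpha> > 0 \<longrightarrow> meets_cone_tangentially \<gamma> at_top p \<and> meets_cone_tangentially \<gamma> at_bot q) \<and>
     (\<alpha> < 0 \<longrightarrow> meets_cone_orthogonally \<gamma> at_top p \<and> meets_cone_orthogonally \<gamma> at_bot q)"
proof -
  let ?w = "log_slope \<alpha> c"
  obtain f g a where fg: "null_pair f g" "a \<noteq> 0"
    and f: "\<And>s. f (\<gamma> s) = r * a * (rho \<alpha> c s * exp s)"
    and g: "\<And>s. g (\<gamma> s) = r / a * (rho \<alpha> c s * exp (- s))"
    and f1: "\<And>s. f (nth_vderiv 1 \<gamma> s) = r * a * (rho \<alpha> c s * (?w s + 1) * exp s)"
    and g1: "\<And>s. g (nth_vderiv 1 \<gamma> s) = r / a * (rho \<alpha> c s * (?w s - 1) * exp (- s))"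
    unfolding \<gamma>_def
    by (rule model_image_null_coordinates[OF assms(1,2), of \<alpha> c])
      (rule that[unfolded \<gamma>_def]; assumption)
  note gf = null_pair_sym[OF fg(1)]
  define k where "k = rho_limit \<alpha>"
  have "k \<noteq> 0" by (simp add: k_def rho_limit_def)
  have "admissible \<alpha> c" using assms(3) by (simp add: admissible_def)
  then have w: "?w s + 1 > 0" "?w s - 1 < 0" for s
    using abs_log_slope_less_1[of \<alpha> c s] by (simp_all add: abs_less_iff)
  have sf: "sgn (f (nth_vderiv 1 \<gamma> s)) = sgn a" and sg: "sgn (g (nth_vderiv 1 \<gamma> s)) = - sgn a" for s
    using w[of s] assms(2) rho_pos[of \<alpha> c s]
    by (simp_all add: f1 g1 sgn_mult sgn_divide)
  have nz: "sgn a \<noteq> 0" "- sgn a \<noteq> 0" using fg(2) by (simp_all add: sgn_if)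
  have f_top: "((\<lambda>s. f (\<gamma> s)) \<longlongrightarrow> r * a * k) at_top"
    and g_bot: "((\<lambda>s. g (\<gamma> s)) \<longlongrightarrow> r / a * k) at_bot"
    unfolding f g k_def by (intro tendsto_mult_left rho_limits assms(3))+
  have g_f: "g (\<gamma> s) = f (\<gamma> s) * (1 / a\<^sup>2 * exp (- 2 * s))" for s
    using fg(2) by (simp add: f g power2_eq_square flip: exp_add)
  have f_g: "f (\<gamma> s) = g (\<gamma> s) * (a\<^sup>2 * exp (2 * s))" for s
    using fg(2) by (simp add: f g power2_eq_square flip: exp_add)
  have "((\<lambda>s. f (\<gamma> s) * (1 / a\<^sup>2 * exp (- 2 * s))) \<longlongrightarrow> r * a * k * (1 / a\<^sup>2 * 0)) at_top"
    by (intro tendsto_mult f_top tendsto_const exp_mult_tendsto_0) simp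
  then have g_top: "((\<lambda>s. g (\<gamma> s)) \<longlongrightarrow> 0) at_top" unfolding g_f by simp
  have "((\<lambda>s. g (\<gamma> s) * (a\<^sup>2 * exp (2 * s))) \<longlongrightarrow> r / a * k * (a\<^sup>2 * 0)) at_bot"
    by (intro tendsto_mult g_bot tendsto_const exp_mult_tendsto_0) simp
  then have f_bot: "((\<lambda>s. f (\<gamma> s)) \<longlongrightarrow> 0) at_bot" unfolding f_g by simp
  have q: "g (nth_vderiv 1 \<gamma> s) / f (nth_vderiv 1 \<gamma> s) = (- 1 / a\<^sup>2) * exp ((- 2 * \<alpha>) * s)"
    "f (nth_vderiv 1 \<gamma> s) / g (nth_vderiv 1 \<gamma> s) = (- a\<^sup>2) * exp ((2 * \<alpha>) * s)" for s
  proof -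
    have e: "exp (- 2 * (\<alpha> - 1) * s) * exp (- s) = exp ((- 2 * \<alpha>) * s) * exp s"
      by (simp add: algebra_simps flip: exp_add)
    have "g (nth_vderiv 1 \<gamma> s) =
        - (r / a * rho \<alpha> c s * (?w s + 1)) * (exp (- 2 * (\<alpha> - 1) * s) * exp (- s))"
      using assms(3) by (simp add: g1 log_slope_minus_1)
    also have "\<dots> = (- 1 / a\<^sup>2) * exp ((- 2 * \<alpha>) * s) * f (nth_vderiv 1 \<gamma> s)"
      unfolding e f1 using fg(2) by (simp add: power2_eq_square)
    finally have g: "g (nth_vderiv 1 \<gamma> s) = (- 1 / a\<^sup>2) * exp ((- 2 * \<alpha>) * s) * f (nth_vderiv 1 \<gamma> s)" .
    have "f (nth_vderiv 1 \<gamma> s) \<noteq> 0" using sf[of s] nz(1) by auto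
    then show "g (nth_vderiv 1 \<gamma> s) / f (nth_vderiv 1 \<gamma> s) = (- 1 / a\<^sup>2) * exp ((- 2 * \<alpha>) * s)"
      "f (nth_vderiv 1 \<gamma> s) / g (nth_vderiv 1 \<gamma> s) = (- a\<^sup>2) * exp ((2 * \<alpha>) * s)"
      using fg(2) by (simp_all add: g exp_minus field_simps)
  qed
  obtain p1 where p1: "f p1 = r * a * k" "g p1 = 0" using null_pair_ex[OF fg(1)] .
  obtain p2 where p2: "g p2 = r / a * k" "f p2 = 0" using null_pair_ex[OF gf] .
  have p0: "f p1 \<noteq> 0" "g p2 \<noteq> 0" using p1 p2 \<open>k \<noteq> 0\<close> assms(2) fg(2) by auto
  note l1 = f_top[folded p1(1)] and l2 = g_bot[folded p2(1)]
  have "meets_cone_tangentially \<gamma> at_top p1 \<and> meets_cone_tangentially \<gamma> at_bot p2" if "\<alpha> > 0"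
  proof
    have "((\<lambda>s. (- 1 / a\<^sup>2) * exp ((- 2 * \<alpha>) * s)) \<longlongrightarrow> (- 1 / a\<^sup>2) * 0) at_top"
      using that by (intro tendsto_mult_left exp_mult_tendsto_0) simp
    then show "meets_cone_tangentially \<gamma> at_top p1"
      by (intro meets_cone_tangentially_null_coordinates[OF fg(1) l1 g_top p0(1) p1(2) sf nz(1)])
         (simp add: q)
    have "((\<lambda>s. (- a\<^sup>2) * exp ((2 * \<alpha>) * s)) \<longlongrightarrow> (- a\<^sup>2) * 0) at_bot"
      using that by (intro tendsto_mult_left exp_mult_tendsto_0) simp
    then show "meets_cone_tangentially \<gamma> at_bot p2"
      by (intro meets_cone_tangentially_null_coordinates[OF gf l2 f_bot p0(2) p2(2) sg nz(2)])
         (simp add: q)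
  qed
  moreover have "meets_cone_orthogonally \<gamma> at_top p1 \<and> meets_cone_orthogonally \<gamma> at_bot p2" if "\<alpha> < 0"
  proof
    have "((\<lambda>s. (- a\<^sup>2) * exp ((2 * \<alpha>) * s)) \<longlongrightarrow> (- a\<^sup>2) * 0) at_top"
      using that by (intro tendsto_mult_left exp_mult_tendsto_0) simp
    then show "meets_cone_orthogonally \<gamma> at_top p1"
      by (intro meets_cone_orthogonally_null_coordinates[OF fg(1) l1 g_top p0(1) p1(2) sg nz(2)])
         (simp add: q)
    have "((\<lambda>s. (- 1 / a\<^sup>2) * exp ((- 2 * \<alpha>) * s)) \<longlongrightarrow> (- 1 / a\<^sup>2) * 0) at_bot"
      using that by (intro tendsto_mult_left exp_mult_tendsto_0) simp
    then show "meets_cone_orthogonally \<gamma> at_bot p2"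
      by (intro meets_cone_orthogonally_null_coordinates[OF gf l2 f_bot p0(2) p2(2) sf nz(1)])
         (simp add: q)
  qed
  moreover have "p1 \<noteq> p2" using p0 p2(2) by auto
  ultimately show ?thesis by blast
qed

lemma model_image_branches:
  fixes \<alpha> c :: real
  assumes L: "linear_isometry L" "r > 0" and c: "admissible \<alpha> c"
    and \<gamma>: "\<gamma> = (\<lambda>s. r *\<^sub>R L (model_curve \<alpha> c s))"
  shows "(\<alpha> > 1 \<longrightarrow>
           (\<exists>a b. a \<noteq> 0 \<and> b \<noteq> 0 \<and> asymptotic_to_cone_at \<gamma> at_top (0, a) \<and>
              asymptotic_to_cone_at \<gamma> at_bot (0, b)) \<and>
           (\<exists>v. v \<noteq> 0 \<and> asymptotic_to_cone_at \<gamma> at_top v \<and> asymptotic_to_cone_at \<gamma> at_bot v)) \<and>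
        (\<alpha> = 1 \<longrightarrow>
           (c = 0 \<and> (\<exists>R. pseudocircle R (range \<gamma>))) \<or>
           (c \<noteq> 0 \<and> asymptotic_to_cone_at \<gamma> at_top 0 \<and> asymptotic_to_cone_at \<gamma> at_bot 0)) \<and>
        (0 < \<alpha> \<and> \<alpha> < 1 \<longrightarrow>
           (\<exists>p q. p \<noteq> q \<and> meets_cone_tangentially \<gamma> at_top p \<and>
              meets_cone_tangentially \<gamma> at_bot q)) \<and>
        (\<alpha> < 0 \<longrightarrow>
           (\<exists>p q. p \<noteq> q \<and> meets_cone_orthogonally \<gamma> at_top p \<and>
              meets_cone_orthogonally \<gamma> at_bot q))"
proof (intro conjI)
  show "\<alpha> > 1 \<longrightarrow>
     (\<exists>a b. a \<noteq> 0 \<and> b \<noteq> 0 \<and> asymptotic_to_cone_at \<gamma> at_top (0, a) \<and>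
        asymptotic_to_cone_at \<gamma> at_bot (0, b)) \<and>
     (\<exists>v. v \<noteq> 0 \<and> asymptotic_to_cone_at \<gamma> at_top v \<and> asymptotic_to_cone_at \<gamma> at_bot v)"
    unfolding \<gamma> by (intro impI model_image_asymptotic_to_translated_cone[OF L])
  show "\<alpha> = 1 \<longrightarrow>
     (c = 0 \<and> (\<exists>R. pseudocircle R (range \<gamma>))) \<or>
     (c \<noteq> 0 \<and> asymptotic_to_cone_at \<gamma> at_top 0 \<and> asymptotic_to_cone_at \<gamma> at_bot 0)"
    using c pseudocircle_range_model_image[OF L] model_image_asymptotic_to_cone[OF L, of c]
    unfolding \<gamma> admissible_def by blast
  show "0 < \<alpha> \<and> \<alpha> < 1 \<longrightarrow>
     (\<exists>p q. p \<noteq> q \<and> meets_cone_tangentially \<gamma> at_top p \<and> meets_cone_tangentially \<gamma> at_bot q)"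
    and "\<alpha> < 0 \<longrightarrow>
     (\<exists>p q. p \<noteq> q \<and> meets_cone_orthogonally \<gamma> at_top p \<and> meets_cone_orthogonally \<gamma> at_bot q)"
    using model_image_meets_cone[OF L, of \<alpha> c] unfolding \<gamma> by auto
qed

section \<open>Classification and maximality\<close>

lemma stationary_iff_model:
  "stationary_timelike_in_cone_plus \<alpha> I \<gamma> \<longleftrightarrow>
     (\<exists>L r c \<phi> K. linear_isometry L \<and> r > 0 \<and> admissible \<alpha> c \<and>
        change_of_parameter \<phi> I K \<and> (\<forall>t\<in>I. \<gamma> t = r *\<^sub>R L (model_curve \<alpha> c (\<phi> t))))"
    (is "?st \<longleftrightarrow> ?model")
proof
  assume ?st
  then show ?model
    unfolding stationary_iff_timelike_solution by (rule timelike_solution_is_model)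
next
  assume ?model
  then obtain L r c \<phi> K where L: "linear_isometry L" "r > 0" "admissible \<alpha> c"
    and \<phi>: "change_of_parameter \<phi> I K" "\<And>t. t \<in> I \<Longrightarrow> \<gamma> t = r *\<^sub>R L (model_curve \<alpha> c (\<phi> t))"
    by blast
  let ?\<beta> = "\<lambda>s. r *\<^sub>R L (model_curve \<alpha> c s)"
  have sol: "timelike_solution \<alpha> UNIV ?\<beta>" by (rule model_image_timelike_solution[OF L])
  have "open_interval K" by (rule change_of_parameter_open_interval[OF \<phi>(1)])
  moreover have "smooth K ?\<beta>"
    using sol by (auto simp: timelike_solution_def intro: smooth_subset)
  ultimately have "timelike_solution \<alpha> K ?\<beta>"
    using sol by (simp add: timelike_solution_def)
  from timelike_solution_reparametrize[OF \<phi>(1) this]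
  show ?st
    unfolding stationary_iff_timelike_solution
    by (rule timelike_solution_cong) (simp add: \<phi>(2))
qed

text \<open>The angle of the image is \<open>s\<close> or \<open>- s\<close> up to an additive constant, according to whether \<open>L\<close> exchanges
  the null lines.\<close>

lemma hyperbolic_angle_surjective_on_model_image:
  assumes "linear_isometry L" "r > 0"
  shows "\<exists>s. hyperbolic_angle (r *\<^sub>R L (model_curve \<alpha> c s)) = x"
proof -
  let ?\<gamma> = "\<lambda>s. r *\<^sub>R L (model_curve \<alpha> c s)"
  obtain f g a where fg: "null_pair f g" "a \<noteq> 0"
    and f: "\<And>s. f (?\<gamma> s) = r * a * (rho \<alpha> c s * exp s)"
    and g: "\<And>s. g (?\<gamma> s) = r / a * (rho \<alpha> c s * exp (- s))"
    by (rule model_image_null_coordinates[OF assms, of \<alpha> c]) (rule that; assumption)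
  have ln: "ln (f (?\<gamma> s) / g (?\<gamma> s)) / 2 = ln (a\<^sup>2) / 2 + s" for s
  proof -
    have "f (?\<gamma> s) / g (?\<gamma> s) = a\<^sup>2 * exp (2 * s)"
      using assms(2) fg(2) rho_pos[of \<alpha> c s]
      by (simp add: f g power2_eq_square field_simps flip: exp_add)
    then show ?thesis using fg(2) by (simp add: ln_mult)
  qed
  from fg(1) show ?thesis
  proof (rule null_pair_cases)
    assume "f = null_plus" "g = null_minus"
    then have "hyperbolic_angle (?\<gamma> (x - ln (a\<^sup>2) / 2)) = x"
      using ln by (simp add: hyperbolic_angle_def)
    then show ?thesis by blast
  next
    assume fg: "f = null_minus" "g = null_plus"
    let ?s = "- x - ln (a\<^sup>2) / 2"
    have "hyperbolic_angle (?\<gamma> ?s) = ln (inverse (f (?\<gamma> ?s) / g (?\<gamma> ?s))) / 2"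
      by (simp add: hyperbolic_angle_def fg)
    also have "\<dots> = - (ln (f (?\<gamma> ?s) / g (?\<gamma> ?s)) / 2)"
      using assms(2) \<open>a \<noteq> 0\<close> rho_pos[of \<alpha> c ?s] 
      by (subst ln_inverse) (simp_all add: f g)
    also have "\<dots> = x" unfolding ln by simp
    finally show ?thesis by blast
  qed
qed

text \<open>If \<open>\<gamma>\<close> runs through a complete model curve, every hyperbolic angle occurs on \<open>\<gamma>\<close>. The angle is
  injective along any stationary timelike \<open>\<beta>\<close> containing \<open>\<gamma>\<close>, so \<open>\<beta>\<close> has no further points.\<close>

lemma maximal_stationary_iff_complete_model:
  "maximal_stationary_timelike_in_cone_plus \<alpha> I \<gamma> \<longleftrightarrow>
     (\<exists>L r c \<phi>. linear_isometry L \<and> r > 0 \<and> admissible \<alpha> c \<and>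
        change_of_parameter \<phi> I UNIV \<and> (\<forall>t\<in>I. \<gamma> t = r *\<^sub>R L (model_curve \<alpha> c (\<phi> t))))"
    (is "?max \<longleftrightarrow> ?model")
proof
  assume max: ?max
  then obtain L r c \<phi> K where L: "linear_isometry L" "r > 0" "admissible \<alpha> c"
    and \<phi>: "change_of_parameter \<phi> I K" "\<forall>t\<in>I. \<gamma> t = r *\<^sub>R L (model_curve \<alpha> c (\<phi> t))"
    unfolding maximal_stationary_timelike_in_cone_plus_def stationary_iff_model by blast
  have "stationary_timelike_in_cone_plus \<alpha> UNIV (\<lambda>s. r *\<^sub>R L (model_curve \<alpha> c s))"
    unfolding stationary_iff_timelike_solution by (rule model_image_timelike_solution[OF L])
  then have "K = UNIV"
    using max \<phi> subset_UNIV unfolding maximal_stationary_timelike_in_cone_plus_def by blast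
  then show ?model using L \<phi> by blast
next
  assume ?model
  then obtain L r c \<phi> where L: "linear_isometry L" "r > 0" "admissible \<alpha> c"
    and \<phi>: "change_of_parameter \<phi> I UNIV"
    and \<gamma>: "\<And>t. t \<in> I \<Longrightarrow> \<gamma> t = r *\<^sub>R L (model_curve \<alpha> c (\<phi> t))"
    by blast
  have "K = J" if \<beta>: "stationary_timelike_in_cone_plus \<alpha> J \<beta>" and \<psi>: "change_of_parameter \<psi> I K"
    and "K \<subseteq> J" and eq: "\<forall>t\<in>I. \<gamma> t = \<beta> (\<psi> t)" for J \<beta> \<psi> K
  proof
    show "J \<subseteq> K"
    proof
      fix j assume "j \<in> J"
      have sol: "timelike_solution \<alpha> J \<beta>" using \<beta> by (simp add: stationary_iff_timelike_solution)
      then have J: "open_interval J" "smooth J \<beta>"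
        and pos: "\<And>t. t \<in> J \<Longrightarrow> lprod (\<beta> t) (\<beta> t) > 0"
        and neg: "\<And>t. t \<in> J \<Longrightarrow> lprod (nth_vderiv 1 \<beta> t) (nth_vderiv 1 \<beta> t) < 0"
        by (auto simp: timelike_solution_def)
      note h = hyperbolic_angle_parameter[OF J pos neg]
      have inj: "inj_on (\<lambda>t. hyperbolic_angle (\<beta> t)) J"
        using J(1) h(1,2) by (intro inj_on_nonzero_derivative) (auto simp: open_interval_def)
      obtain s where "hyperbolic_angle (r *\<^sub>R L (model_curve \<alpha> c s)) = hyperbolic_angle (\<beta> j)"
        using hyperbolic_angle_surjective_on_model_image[OF L(1,2)] by blast
      moreover have "s \<in> \<phi> ` I"
        using \<phi> by (simp add: change_of_parameter_def)
      then obtain t where t: "t \<in> I" "\<phi> t = s" by blast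
      ultimately have "hyperbolic_angle (\<beta> (\<psi> t)) = hyperbolic_angle (\<beta> j)"
        using \<gamma>[OF t(1)] eq by simp
      moreover have "\<psi> t \<in> K" using \<psi> t(1) by (auto simp: change_of_parameter_def)
      ultimately show "j \<in> K"
        using inj \<open>j \<in> J\<close> \<open>K \<subseteq> J\<close> by (auto dest: inj_onD)
    qed
  qed fact
  moreover have "stationary_timelike_in_cone_plus \<alpha> I \<gamma>"
    unfolding stationary_iff_model using L \<phi> \<gamma> by blast
  ultimately show ?max
    unfolding maximal_stationary_timelike_in_cone_plus_def by blast
qed

theorem theorem4p4:
  fixes \<alpha> :: real
  shows
    "(\<forall>I \<gamma>. stationary_timelike_in_cone_plus \<alpha> I \<gamma> \<longleftrightarrow>
        (\<exists>L r c \<phi> K. linear_isometry L \<and> r > 0 \<and> admissible \<alpha> c \<and>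
           change_of_parameter \<phi> I K \<and> (\<forall>t\<in>I. \<gamma> t = r *\<^sub>R L (model_curve \<alpha> c (\<phi> t))))) \<and>
     (\<forall>I \<gamma>. maximal_stationary_timelike_in_cone_plus \<alpha> I \<gamma> \<longleftrightarrow>
        (\<exists>L r c \<phi>. linear_isometry L \<and> r > 0 \<and> admissible \<alpha> c \<and>
           change_of_parameter \<phi> I UNIV \<and> (\<forall>t\<in>I. \<gamma> t = r *\<^sub>R L (model_curve \<alpha> c (\<phi> t))))) \<and>
     (\<forall>L r c \<gamma>. linear_isometry L \<and> r > 0 \<and> admissible \<alpha> c \<and>
        \<gamma> = (\<lambda>s. r *\<^sub>R L (model_curve \<alpha> c s)) \<longrightarrow>
        (\<alpha> > 1 \<longrightarrow>
           (\<exists>a b. a \<noteq> 0 \<and> b \<noteq> 0 \<and> asymptotic_to_cone_at \<gamma> at_top (0, a) \<and>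
              asymptotic_to_cone_at \<gamma> at_bot (0, b)) \<and>
           (\<exists>v. v \<noteq> 0 \<and> asymptotic_to_cone_at \<gamma> at_top v \<and> asymptotic_to_cone_at \<gamma> at_bot v)) \<and>
        (\<alpha> = 1 \<longrightarrow>
           (c = 0 \<and> (\<exists>R. pseudocircle R (range \<gamma>))) \<or>
           (c \<noteq> 0 \<and> asymptotic_to_cone_at \<gamma> at_top 0 \<and> asymptotic_to_cone_at \<gamma> at_bot 0)) \<and>
        (0 < \<alpha> \<and> \<alpha> < 1 \<longrightarrow>
           (\<exists>p q. p \<noteq> q \<and> meets_cone_tangentially \<gamma> at_top p \<and>
              meets_cone_tangentially \<gamma> at_bot q)) \<and>
        (\<alpha> < 0 \<longrightarrow>
           (\<exists>p q. p \<noteq> q \<and> meets_cone_orthogonally \<gamma> at_top p \<and>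
              meets_cone_orthogonally \<gamma> at_bot q)))"
  by (rule conjI[OF _ conjI]; intro allI impI; (elim conjE)?;
      rule stationary_iff_model maximal_stationary_iff_complete_model model_image_branches)

end
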